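(* Let $p\colon E\to B$ be a fibration and let $R$ be a commutative ring. If there exist relative cohomology classes $v_1,\dots, v_k \in H^*(SP^2_B(E), dE_B; R)$ such that $$0 \neq v_1\smile \dots \smile v_k \in H^*(SP^2_B(E), dE_B; R),$$ then $\mathrm{TC}^{M,\, \Sigma}[p\colon E\to B]\geq k$.
   Context: Fibration means Hurewicz fibration, $I=[0,1]$, $G = \mathbb{Z}_2 = \langle g\rangle$. For a fibration $p \colon E \to B$: $E \times_B E = \{(e_1,e_2)\in E\times E \mid p(e_1)=p(e_2)\}$ with $g\cdot(e_1,e_2)=(e_2,e_1)$ and diagonal $\Delta E = \{(e,e)\mid e \in E\}$; $E^I_B = \{\gamma \in E^I \mid p\circ\gamma \text{ is constant}\}$ (subspace of $E^I$ with compact-open topology) with $(g\cdot\gamma)(t)=\gamma(1-t)$; $\Pi \colon E^I_B \to E \times_B E$, $\Pi(\gamma)=(\gamma(0),\gamma(1))$, is a $G$-fibration; $\mathrm{c}_e$ is the constant path at $e$. The fibrewise symmetric square is the orbit space $SP^2_B(E) := (E\times_B E)/G$, with orbit map $\rho \colon E\times_B E \to SP^2_B(E)$, and $dE_B := \rho(\Delta E)$. The monoidal symmetrized parametrized topological complexity $\mathrm{TC}^{M,\,\Sigma}[p \colon E\to B]$ is the least nonnegative integer $n$ such that $E \times_B E$ may be covered by $G$-invariant open subsets $U_0,\dots,U_n$, each of which contains $\Delta E$ and admits a continuous $G$-equivariant section $\sigma_i \colon U_i \to E^I_B$ of $\Pi$ such that $\sigma_i(e,e) = \mathrm{c}_e$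 for all $e \in E$ ($\infty$ if none exists). *)

theory Defs
  imports "HOL-Analysis.Analysis" "HOL-Homology.Homology" "HOL-Library.Extended_Nat"
begin

section \<open>Point-set topology\<close>

abbreviation unit_interval :: "real topology" where
  "unit_interval \<equiv> top_of_set {0..1}"

text \<open>Maps are made canonical by requiring them to be \<open>undefined\<close> outside the domain, so that
  equality of functions is equality of maps. Taking \<open>K = {}\<close> shows that the topology generated below
  has the set of all maps as its underlying set.\<close>

definition compact_open_topology :: "'a topology \<Rightarrow> 'b topology \<Rightarrow> ('a \<Rightarrow> 'b) topology" where
  "compact_open_topology X Y =
     topology_generated_by
       {{f \<in> extensional (topspace X). continuous_map X Y f \<and> f ` K \<subseteq> U} |K U.
          compactin X K \<and> openin Y U}"

definition quotient_topology :: "'a topology \<Rightarrow> ('a \<Rightarrow> 'b) \<Rightarrow> 'b topology" where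
  "quotient_topology X f =
     topology (\<lambda>U. U \<subseteq> f ` topspace X \<and> openin X {x \<in> topspace X. f x \<in> U})"

lemma topspace_compact_open_topology:
  "topspace (compact_open_topology X Y) = {f \<in> extensional (topspace X). continuous_map X Y f}"
proof -
  have "{f \<in> extensional (topspace X). continuous_map X Y f \<and> f ` {} \<subseteq> {}}
          \<in> {{f \<in> extensional (topspace X). continuous_map X Y f \<and> f ` K \<subseteq> U} |K U.
               compactin X K \<and> openin Y U}"
    using compactin_empty openin_empty by blast
  then show ?thesis
    unfolding compact_open_topology_def topology_generated_by_topspace by blast
qed

lemma openin_quotient_topology:
  "openin (quotient_topology X f) U \<longleftrightarrow>
     U \<subseteq> f ` topspace X \<and> openin X {x \<in> topspace X. f x \<in> U}"
proof -
  have "istopology (\<lambda>U. U \<subseteq> f ` topspace X \<and> openin X {x \<in> topspace X. f x \<in> U})"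
    unfolding istopology_def
  proof (intro conjI allI impI)
    fix S T
    assume "S \<subseteq> f ` topspace X \<and> openin X {x \<in> topspace X. f x \<in> S}"
      and "T \<subseteq> f ` topspace X \<and> openin X {x \<in> topspace X. f x \<in> T}"
    moreover have "{x \<in> topspace X. f x \<in> S \<inter> T}
        = {x \<in> topspace X. f x \<in> S} \<inter> {x \<in> topspace X. f x \<in> T}" by blast
    ultimately show "S \<inter> T \<subseteq> f ` topspace X" "openin X {x \<in> topspace X. f x \<in> S \<inter> T}"
      by auto
  next
    fix \<K>
    assume *: "\<forall>K\<in>\<K>. K \<subseteq> f ` topspace X \<and> openin X {x \<in> topspace X. f x \<in> K}"
    then show "\<Union>\<K> \<subseteq> f ` topspace X" by blast
    have "{x \<in> topspace X. f x \<in> \<Union>\<K>} = (\<Union>K\<in>\<K>. {x \<in> topspace X. f x \<in> K})" by blast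
    with * show "openin X {x \<in> topspace X. f x \<in> \<Union>\<K>}" by auto
  qed
  then show ?thesis
    by (simp add: quotient_topology_def)
qed

lemma topspace_quotient_topology: "topspace (quotient_topology X f) = f ` topspace X"
proof
  show "topspace (quotient_topology X f) \<subseteq> f ` topspace X"
    using openin_topspace [of "quotient_topology X f"] by (simp only: openin_quotient_topology)
  have "{x \<in> topspace X. f x \<in> f ` topspace X} = topspace X" by blast
  then have "openin (quotient_topology X f) (f ` topspace X)"
    by (simp only: openin_quotient_topology openin_topspace) blast
  then show "f ` topspace X \<subseteq> topspace (quotient_topology X f)"
    by (rule openin_subset)
qed

lemma quotient_map_quotient_topology: "quotient_map X (quotient_topology X f) f"
  unfolding quotient_map_def topspace_quotient_topology openin_quotient_topology by simp


section \<open>Hurewicz fibrations\<close>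

definition homotopy_lifting_property ::
    "'x topology \<Rightarrow> 'e topology \<Rightarrow> 'b topology \<Rightarrow> ('e \<Rightarrow> 'b) \<Rightarrow> bool" where
  "homotopy_lifting_property X E B p \<longleftrightarrow>
     (\<forall>h f. continuous_map (prod_topology X unit_interval) B h \<and> continuous_map X E f \<and>
            (\<forall>x\<in>topspace X. h (x, 0) = p (f x)) \<longrightarrow>
        (\<exists>H. continuous_map (prod_topology X unit_interval) E H \<and>
             (\<forall>x\<in>topspace X. H (x, 0) = f x) \<and>
             (\<forall>x\<in>topspace X. \<forall>t\<in>{0..1}. p (H (x, t)) = h (x, t))))"

text \<open>A definition cannot quantify over all types. Quantifying over the spaces that live on the type
  \<open>'e \<times> (real \<Rightarrow> 'b)\<close> of the mapping path space of \<open>p\<close> is enough to obtain the homotopy lifting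
  property for all spaces on all types: this is \<open>hurewicz_fibrationD\<close> below.\<close>

definition hurewicz_fibration :: "'e topology \<Rightarrow> 'b topology \<Rightarrow> ('e \<Rightarrow> 'b) \<Rightarrow> bool" where
  "hurewicz_fibration E B p \<longleftrightarrow>
     continuous_map E B p \<and>
     (\<forall>X :: ('e \<times> (real \<Rightarrow> 'b)) topology. homotopy_lifting_property X E B p)"

lemma continuous_map_path_eval:
  "continuous_map (prod_topology (compact_open_topology unit_interval Y) unit_interval) Y
     (\<lambda>(\<gamma>, t). \<gamma> t)"
proof -
  let ?C = "compact_open_topology unit_interval Y"
  let ?M = "\<lambda>K U. {f \<in> extensional {0..1::real}. continuous_map unit_interval Y f \<and> f ` K \<subseteq> U}"
  let ?P = "prod_topology ?C unit_interval"
  have sub: "openin ?C (?M K U)" if "compactin unit_interval K" "openin Y U" for K U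
    unfolding compact_open_topology_def
    by (rule topology_generated_by_Basis) (use that in auto)
  have op: "openin ?P {z \<in> topspace ?P. (\<lambda>(\<gamma>, t). \<gamma> t) z \<in> U}" if U: "openin Y U" for U
  proof (subst openin_subopen, intro ballI)
    fix z assume z: "z \<in> {z \<in> topspace ?P. (\<lambda>(\<gamma>, t). \<gamma> t) z \<in> U}"
    obtain \<gamma> t where zz: "z = (\<gamma>, t)" by fastforce
    have g: "\<gamma> \<in> extensional {0..1}" "continuous_map unit_interval Y \<gamma>"
      and t: "t \<in> {0..1}" and gt: "\<gamma> t \<in> U"
      using z by (auto simp: zz topspace_compact_open_topology)
    have "openin unit_interval {s \<in> {0..1}. \<gamma> s \<in> U}"
      using openin_continuous_map_preimage [OF g(2) U] by simp
    then obtain e where e: "e > 0" "ball t e \<inter> {0..1} \<subseteq> {s \<in> {0..1}. \<gamma> s \<in> U}"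
      using t gt unfolding openin_contains_ball by blast
    define K where "K = cball t (e/2) \<inter> {0..1}"
    have "compact K" unfolding K_def by (simp add: compact_Int_closed)
    then have K: "compactin unit_interval K"
      by (auto simp: K_def compactin_subtopology)
    have gK: "\<gamma> ` K \<subseteq> U" 
    proof
      fix y assume "y \<in> \<gamma> ` K"
      then obtain s where s: "y = \<gamma> s" "s \<in> cball t (e/2)" "s \<in> {0..1}"
        unfolding K_def by blast
      then have "s \<in> ball t e" using e(1) by simp
      with s e(2) show "y \<in> U" by blast
    qed
    let ?W = "?M K U \<times> (ball t (e/2) \<inter> {0..1})"
    have "openin unit_interval (ball t (e/2) \<inter> {0..1})"
      by (simp add: Int_commute openin_open_Int)
    then have "openin ?P ?W"
      using sub [OF K U] by (simp add: openin_prod_Times_iff)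
    moreover have "z \<in> ?W" using g t gK e(1) by (simp add: zz)
    moreover have "?W \<subseteq> {z \<in> topspace ?P. (\<lambda>(\<gamma>, t). \<gamma> t) z \<in> U}"
    proof
      fix w assume w: "w \<in> ?W"
      obtain \<delta> s where ww: "w = (\<delta>, s)" by fastforce
      have "s \<in> K" "\<delta> ` K \<subseteq> U" using w by (simp_all add: ww K_def)
      then show "w \<in> {z \<in> topspace ?P. (\<lambda>(\<gamma>, t). \<gamma> t) z \<in> U}"
        using w by (simp add: ww topspace_compact_open_topology image_subset_iff)
    qed
    ultimately show "\<exists>T. openin ?P T \<and> z \<in> T \<and> T \<subseteq> {z \<in> topspace ?P. (\<lambda>(\<gamma>, t). \<gamma> t) z \<in> U}"
      by blast
  qed
  show ?thesis
    unfolding continuous_map_def [of ?P]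
  proof (intro conjI allI impI)
    show "openin ?P {z \<in> topspace ?P. (\<lambda>(\<gamma>, t). \<gamma> t) z \<in> U}" if "openin Y U" for U
      using op [OF that] .
    have "(\<lambda>(\<gamma>, t). \<gamma> t) (\<gamma>, t) \<in> topspace Y"
      if "\<gamma> \<in> topspace ?C" "t \<in> {0..1}" for \<gamma> t
      using that by (simp add: topspace_compact_open_topology continuous_map_def Pi_iff)
    then show "(\<lambda>(\<gamma>, t). \<gamma> t) \<in> topspace ?P \<rightarrow> topspace Y"
      by (simp add: Pi_iff split_paired_all)
  qed
qed

lemma continuous_map_path_curry:
  assumes h: "continuous_map (prod_topology X unit_interval) Y h"
  shows "continuous_map X (compact_open_topology unit_interval Y) (\<lambda>x. \<lambda>t\<in>{0..1}. h (x, t))"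
proof -
  have slice: "continuous_map unit_interval Y (\<lambda>t\<in>{0..1}. h (x, t))" if x: "x \<in> topspace X" for x
  proof -
    have "continuous_map unit_interval (prod_topology X unit_interval) (\<lambda>t. (x, t))"
      using x by (simp add: continuous_map_pairwise o_def)
    then have "continuous_map unit_interval Y (h \<circ> (\<lambda>t. (x, t)))"
      using h continuous_map_compose by blast
    then show ?thesis
      by (rule continuous_map_eq) auto
  qed
  show ?thesis
    unfolding compact_open_topology_def
  proof (rule continuous_on_generated_topo)
    fix V
    assume "V \<in> {{f \<in> extensional (topspace unit_interval).
                    continuous_map unit_interval Y f \<and> f ` K \<subseteq> U} |K U.
                    compactin unit_interval K \<and> openin Y U}"
    then obtain K U where K: "compactin unit_interval K" and U: "openin Y U"
      and V: "V = {f \<in> extensional (topspace unit_interval).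
                    continuous_map unit_interval Y f \<and> f ` K \<subseteq> U}" by blast
    have K01: "K \<subseteq> {0..1}" using K by (simp add: compactin_subtopology)
    have VX: "(\<lambda>x. \<lambda>t\<in>{0..1}. h (x, t)) -` V \<inter> topspace X
              = {x \<in> topspace X. \<forall>t\<in>K. h (x, t) \<in> U}"
      using slice K01 by (auto simp: V image_subset_iff subset_iff)
    let ?O = "{z \<in> topspace (prod_topology X unit_interval). h z \<in> U}"
    have O: "openin (prod_topology X unit_interval) ?O"
      using openin_continuous_map_preimage [OF h U] .
    have "openin X {x \<in> topspace X. \<forall>t\<in>K. h (x, t) \<in> U}"
    proof (subst openin_subopen, intro ballI)
      fix x assume x: "x \<in> {x \<in> topspace X. \<forall>t\<in>K. h (x, t) \<in> U}"
      have "compactin X {x}" using x by simp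
      moreover have "{x} \<times> K \<subseteq> ?O" using x K01 by auto
      ultimately obtain A C where AC: "openin X A" "{x} \<subseteq> A" "K \<subseteq> C" "A \<times> C \<subseteq> ?O"
        by (rule Wallace_theorem_prod_topology [OF _ K O])
      have "A \<subseteq> {x \<in> topspace X. \<forall>t\<in>K. h (x, t) \<in> U}"
      proof
        fix y assume y: "y \<in> A"
        then have "h (y, t) \<in> U" if "t \<in> K" for t
          using AC(3,4) that by blast
        then show "y \<in> {x \<in> topspace X. \<forall>t\<in>K. h (x, t) \<in> U}"
          using y openin_subset [OF AC(1)] by blast
      qed
      with AC show "\<exists>T. openin X T \<and> x \<in> T \<and> T \<subseteq> {x \<in> topspace X. \<forall>t\<in>K. h (x, t) \<in> U}"
        by blast
    qed
    with VX show "openin X ((\<lambda>x. \<lambda>t\<in>{0..1}. h (x, t)) -` V \<inter> topspace X)" by simp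
  next
    have "(\<lambda>t\<in>{0..1}. h (x, t)) \<in> topspace (compact_open_topology unit_interval Y)"
      if "x \<in> topspace X" for x
      using slice [OF that] by (simp add: topspace_compact_open_topology)
    then have "(\<lambda>x. \<lambda>t\<in>{0..1}. h (x, t)) ` topspace X
        \<subseteq> topspace (compact_open_topology unit_interval Y)"
      by (rule image_subsetI)
    then show "(\<lambda>x. \<lambda>t\<in>{0..1}. h (x, t)) ` topspace X \<subseteq>
      \<Union> {{f \<in> extensional (topspace unit_interval).
                    continuous_map unit_interval Y f \<and> f ` K \<subseteq> U} |K U.
                    compactin unit_interval K \<and> openin Y U}"
      unfolding compact_open_topology_def topology_generated_by_topspace .
  qed
qed

lemma hurewicz_fibrationD:
  fixes X :: "'x topology"
  assumes "hurewicz_fibration E B p"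
  shows "homotopy_lifting_property X E B p"
  unfolding homotopy_lifting_property_def
proof (intro allI impI, elim conjE)
  fix h f
  assume h: "continuous_map (prod_topology X unit_interval) B h"
    and f: "continuous_map X E f" and hf: "\<forall>x\<in>topspace X. h (x, 0) = p (f x)"
  let ?C = "compact_open_topology unit_interval B"
  define P where "P = subtopology (prod_topology E ?C) {(e, \<gamma>). \<gamma> 0 = p e}"
  have sn: "continuous_map P ?C snd" and fs: "continuous_map P E fst"
    by (simp_all add: P_def continuous_map_from_subtopology continuous_map_fst continuous_map_snd)
  have PI: "continuous_map (prod_topology P unit_interval) (prod_topology ?C unit_interval)
              (\<lambda>z. (snd (fst z), snd z))"
    using continuous_map_compose [OF continuous_map_fst sn]
    by (intro continuous_map_pairedI) (simp_all add: o_def continuous_map_snd)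
  have ev: "continuous_map (prod_topology P unit_interval) B (\<lambda>z. snd (fst z) (snd z))"
    using continuous_map_compose [OF PI continuous_map_path_eval] by (simp add: o_def)
  have "homotopy_lifting_property P E B p"
    using assms by (simp add: hurewicz_fibration_def)
  moreover have "\<forall>z\<in>topspace P. snd (fst (z, 0::real)) (snd (z, 0::real)) = p (fst z)"
    by (auto simp: P_def)
  ultimately have "\<exists>L. continuous_map (prod_topology P unit_interval) E L \<and>
       (\<forall>z\<in>topspace P. L (z, 0) = fst z) \<and>
       (\<forall>z\<in>topspace P. \<forall>t\<in>{0..1}. p (L (z, t)) = snd (fst (z, t)) (snd (z, t)))"
    unfolding homotopy_lifting_property_def using ev fs by blast
  then obtain L where L: "continuous_map (prod_topology P unit_interval) E L"
     "\<And>z. z \<in> topspace P \<Longrightarrow> L (z, 0) = fst z"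
     "\<And>z t. z \<in> topspace P \<Longrightarrow> t \<in> {0..1} \<Longrightarrow> p (L (z, t)) = snd z t"
    unfolding fst_conv snd_conv by blast
  define u where "u = (\<lambda>x. (f x, \<lambda>t\<in>{0..1}. h (x, t)))"
  have u: "continuous_map X P u"
    unfolding P_def u_def continuous_map_in_subtopology
    using f continuous_map_path_curry [OF h] hf by (auto simp: continuous_map_pairwise o_def)
  have uX: "u x \<in> topspace P" if "x \<in> topspace X" for x
    using u that by (auto simp: continuous_map_def)
  have "continuous_map (prod_topology X unit_interval) (prod_topology P unit_interval)
           (\<lambda>z. (u (fst z), snd z))"
    using continuous_map_compose [OF continuous_map_fst u]
    by (intro continuous_map_pairedI) (simp_all add: o_def continuous_map_snd)
  then have "continuous_map (prod_topology X unit_interval) E (\<lambda>z. L (u (fst z), snd z))"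
    using continuous_map_compose [OF _ L(1)] unfolding o_def by blast
  then show "\<exists>H. continuous_map (prod_topology X unit_interval) E H \<and>
             (\<forall>x\<in>topspace X. H (x, 0) = f x) \<and>
             (\<forall>x\<in>topspace X. \<forall>t\<in>{0..1}. p (H (x, t)) = h (x, t))"
    using L(2,3) uX by (intro exI [of _ "\<lambda>z. L (u (fst z), snd z)"]) (simp add: u_def)
qed


section \<open>Monoidal symmetrized parametrized topological complexity\<close>

text \<open>The generator of \<open>\<int>\<^sub>2\<close> acts on \<open>E \<times>\<^sub>B E\<close> by \<^const>\<open>prod.swap\<close> and on \<open>E\<^sup>I\<^sub>B\<close> by
  \<open>reverse_path\<close>.\<close>

definition fibre_square :: "'e topology \<Rightarrow> ('e \<Rightarrow> 'b) \<Rightarrow> ('e \<times> 'e) topology" where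
  "fibre_square E p = subtopology (prod_topology E E) {(e1, e2). p e1 = p e2}"

definition fibre_diagonal :: "'e topology \<Rightarrow> ('e \<times> 'e) set" where
  "fibre_diagonal E = {(e, e) |e. e \<in> topspace E}"

definition fibre_path_space :: "'e topology \<Rightarrow> ('e \<Rightarrow> 'b) \<Rightarrow> (real \<Rightarrow> 'e) topology" where
  "fibre_path_space E p =
     subtopology (compact_open_topology unit_interval E) {\<gamma>. \<exists>b. \<forall>t\<in>{0..1}. p (\<gamma> t) = b}"

definition reverse_path :: "(real \<Rightarrow> 'e) \<Rightarrow> real \<Rightarrow> 'e" where
  "reverse_path \<gamma> = (\<lambda>t\<in>{0..1}. \<gamma> (1 - t))"

definition const_path :: "'e \<Rightarrow> real \<Rightarrow> 'e" where
  "const_path e = (\<lambda>t\<in>{0..1}. e)"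

definition path_endpoints :: "(real \<Rightarrow> 'e) \<Rightarrow> 'e \<times> 'e" where
  "path_endpoints \<gamma> = (\<gamma> 0, \<gamma> 1)"

definition monoidal_symmetrized_domain :: "'e topology \<Rightarrow> ('e \<Rightarrow> 'b) \<Rightarrow> ('e \<times> 'e) set \<Rightarrow> bool" where
  "monoidal_symmetrized_domain E p U \<longleftrightarrow>
     openin (fibre_square E p) U \<and> prod.swap ` U = U \<and> fibre_diagonal E \<subseteq> U \<and>
     (\<exists>s. continuous_map (subtopology (fibre_square E p) U) (fibre_path_space E p) s \<and>
          (\<forall>z\<in>U. path_endpoints (s z) = z) \<and>
          (\<forall>z\<in>U. s (prod.swap z) = reverse_path (s z)) \<and>
          (\<forall>e\<in>topspace E. s (e, e) = const_path e))"

text \<open>The infimum of the empty set of extended natural numbers is \<open>\<infinity>\<close>.\<close>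

definition TC_monoidal_symmetrized :: "'e topology \<Rightarrow> ('e \<Rightarrow> 'b) \<Rightarrow> enat" where
  "TC_monoidal_symmetrized E p =
     Inf {enat n |n. \<exists>U :: nat \<Rightarrow> ('e \<times> 'e) set.
            (\<forall>i\<le>n. monoidal_symmetrized_domain E p (U i)) \<and>
            topspace (fibre_square E p) = (\<Union>i\<le>n. U i)}"

text \<open>Points of the fibrewise symmetric square are the orbits \<open>{(e\<^sub>1, e\<^sub>2), (e\<^sub>2, e\<^sub>1)}\<close>.\<close>

definition swap_orbit :: "'e \<times> 'e \<Rightarrow> ('e \<times> 'e) set" where
  "swap_orbit z = {z, prod.swap z}"

definition fibre_sym_square :: "'e topology \<Rightarrow> ('e \<Rightarrow> 'b) \<Rightarrow> ('e \<times> 'e) set topology" where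
  "fibre_sym_square E p = quotient_topology (fibre_square E p) swap_orbit"

definition fibre_sym_diagonal :: "'e topology \<Rightarrow> ('e \<times> 'e) set set" where
  "fibre_sym_diagonal E = swap_orbit ` fibre_diagonal E"


section \<open>Relative singular cohomology with coefficients in a commutative ring\<close>

text \<open>An \<open>n\<close>-cochain is a function on singular \<open>n\<close>-simplices, made canonical by requiring it to
  vanish on everything that is not a singular \<open>n\<close>-simplex of the space. A cochain of the pair
  \<open>(X, A)\<close> also vanishes on the simplices of \<open>A\<close>.\<close>

type_synonym ('a, 'r) cochain = "((nat \<Rightarrow> real) \<Rightarrow> 'a) \<Rightarrow> 'r"

definition cochain_eval :: "('a, 'r::comm_ring_1) cochain \<Rightarrow> 'a chain \<Rightarrow> 'r" where
  "cochain_eval \<phi> c = (\<Sum>\<sigma>\<in>Poly_Mapping.keys c. of_int (Poly_Mapping.lookup c \<sigma>) * \<phi> \<sigma>)"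

definition coboundary ::
    "nat \<Rightarrow> 'a topology \<Rightarrow> ('a, 'r::comm_ring_1) cochain \<Rightarrow> ('a, 'r) cochain" where
  "coboundary n X \<phi> =
     (\<lambda>\<sigma>. if singular_simplex (Suc n) X \<sigma>
          then cochain_eval \<phi> (chain_boundary (Suc n) (frag_of \<sigma>)) else 0)"

definition relcochain_set ::
    "nat \<Rightarrow> 'a topology \<Rightarrow> 'a set \<Rightarrow> ('a, 'r::comm_ring_1) cochain set" where
  "relcochain_set n X A =
     {\<phi>. (\<forall>\<sigma>. \<not> singular_simplex n X \<sigma> \<longrightarrow> \<phi> \<sigma> = 0) \<and>
         (\<forall>\<sigma>. singular_simplex n (subtopology X A) \<sigma> \<longrightarrow> \<phi> \<sigma> = 0)}"

definition relcocycle_set ::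
    "nat \<Rightarrow> 'a topology \<Rightarrow> 'a set \<Rightarrow> ('a, 'r::comm_ring_1) cochain set" where
  "relcocycle_set n X A = {\<phi> \<in> relcochain_set n X A. coboundary n X \<phi> = (\<lambda>_. 0)}"

definition relcoboundary_set ::
    "nat \<Rightarrow> 'a topology \<Rightarrow> 'a set \<Rightarrow> ('a, 'r::comm_ring_1) cochain set" where
  "relcoboundary_set n X A =
     (case n of 0 \<Rightarrow> {\<lambda>_. 0} | Suc m \<Rightarrow> coboundary m X ` relcochain_set m X A)"

definition relcocycle_group ::
    "nat \<Rightarrow> 'a topology \<Rightarrow> 'a set \<Rightarrow> ('a, 'r::comm_ring_1) cochain monoid" where
  "relcocycle_group n X A =
     \<lparr>carrier = relcocycle_set n X A, monoid.mult = (\<lambda>\<phi> \<psi> \<sigma>. \<phi> \<sigma> + \<psi> \<sigma>), one = (\<lambda>_. 0)\<rparr>"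

definition relative_cohomology_group ::
    "nat \<Rightarrow> 'a topology \<Rightarrow> 'a set \<Rightarrow> ('a, 'r::comm_ring_1) cochain set monoid" where
  "relative_cohomology_group n X A = relcocycle_group n X A Mod relcoboundary_set n X A"

definition cohomology_class ::
    "nat \<Rightarrow> 'a topology \<Rightarrow> 'a set \<Rightarrow> ('a, 'r::comm_ring_1) cochain \<Rightarrow> ('a, 'r) cochain set" where
  "cohomology_class n X A \<phi> = r_coset (relcocycle_group n X A) (relcoboundary_set n X A) \<phi>"

text \<open>The total group \<open>H\<^sup>*(X, A) = \<Oplus>\<^sub>n H\<^sup>n(X, A)\<close>, written multiplicatively: its zero element is
  \<open>\<one>\<^bsub>relative_cohomology X A\<^esub>\<close>.\<close>

definition relative_cohomology ::
    "'a topology \<Rightarrow> 'a set \<Rightarrow> (nat \<Rightarrow> ('a, 'r::comm_ring_1) cochain set) monoid" where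
  "relative_cohomology X A = sum_group UNIV (\<lambda>n. relative_cohomology_group n X A)"

lemma cochain_eval_superset:
  assumes "finite S" "Poly_Mapping.keys c \<subseteq> S"
  shows "cochain_eval \<phi> c = (\<Sum>\<sigma>\<in>S. of_int (Poly_Mapping.lookup c \<sigma>) * \<phi> \<sigma>)"
  unfolding cochain_eval_def
  by (rule sum.mono_neutral_left) (use assms in \<open>auto simp: in_keys_iff\<close>)

lemma cochain_eval_0 [simp]: "cochain_eval \<phi> 0 = 0"
  by (simp add: cochain_eval_def)

lemma cochain_eval_of [simp]: "cochain_eval \<phi> (frag_of \<sigma>) = \<phi> \<sigma>"
  by (simp add: cochain_eval_def)

lemma cochain_eval_add: "cochain_eval \<phi> (c + d) = cochain_eval \<phi> c + cochain_eval \<phi> d"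
proof -
  let ?S = "Poly_Mapping.keys c \<union> Poly_Mapping.keys d"
  have "finite ?S" by simp
  moreover have "Poly_Mapping.keys (c + d) \<subseteq> ?S" by (rule keys_add)
  ultimately show ?thesis
    by (simp add: cochain_eval_superset [of ?S] lookup_add distrib_right sum.distrib)
qed

lemma cochain_eval_cmul: "cochain_eval \<phi> (frag_cmul a c) = of_int a * cochain_eval \<phi> c"
proof -
  have "Poly_Mapping.keys (frag_cmul a c) \<subseteq> Poly_Mapping.keys c" by (rule keys_cmul)
  then show ?thesis
    by (simp add: cochain_eval_superset [of "Poly_Mapping.keys c"] sum_distrib_left mult.assoc)
qed

lemma cochain_eval_sum: "cochain_eval \<phi> (sum f I) = (\<Sum>i\<in>I. cochain_eval \<phi> (f i))"
  by (induction I rule: infinite_finite_induct) (simp_all add: cochain_eval_add)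

lemma cochain_eval_boundary:
  "cochain_eval \<phi> (chain_boundary (Suc n) (frag_of \<sigma>)) =
     (\<Sum>k\<le>Suc n. (-1) ^ k * \<phi> (singular_face (Suc n) k \<sigma>))"
  by (simp add: chain_boundary_of cochain_eval_sum cochain_eval_cmul cochain_eval_add)

lemma coboundary_simplex:
  assumes "singular_simplex (Suc n) X \<sigma>"
  shows "coboundary n X \<phi> \<sigma> = (\<Sum>k\<le>Suc n. (-1) ^ k * \<phi> (singular_face (Suc n) k \<sigma>))"
  using assms by (simp only: coboundary_def cochain_eval_boundary if_True)

lemma coboundary_nonsimplex:
  "\<not> singular_simplex (Suc n) X \<sigma> \<Longrightarrow> coboundary n X \<phi> \<sigma> = 0"
  by (simp add: coboundary_def)

lemma coboundary_add:
  "coboundary n X (\<lambda>\<sigma>. \<phi> \<sigma> + \<psi> \<sigma>) = (\<lambda>\<sigma>. coboundary n X \<phi> \<sigma> + coboundary n X \<psi> \<sigma>)"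
  by (rule ext) (simp add: coboundary_def cochain_eval_def distrib_left sum.distrib)

lemma coboundary_cmul:
  "coboundary n X (\<lambda>\<sigma>. a * \<phi> \<sigma>) = (\<lambda>\<sigma>. a * coboundary n X \<phi> \<sigma>)"
  by (rule ext) (simp add: coboundary_def cochain_eval_def sum_distrib_left mult.left_commute)

lemma coboundary_minus: "coboundary n X (\<lambda>\<sigma>. - \<phi> \<sigma>) = (\<lambda>\<sigma>. - coboundary n X \<phi> \<sigma>)"
  using coboundary_cmul [of n X "-1" \<phi>] by simp

lemma coboundary_zero: "coboundary n X (\<lambda>_. 0) = (\<lambda>_. 0)"
  by (rule ext) (simp add: coboundary_def cochain_eval_def)

lemma coboundary_coboundary: "coboundary (Suc n) X (coboundary n X \<phi>) = (\<lambda>_. 0)"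
proof
  fix \<sigma>
  show "coboundary (Suc n) X (coboundary n X \<phi>) \<sigma> = 0"
  proof (cases "singular_simplex (Suc (Suc n)) X \<sigma>")
    case True
    let ?f = "\<lambda>k. singular_face (Suc (Suc n)) k \<sigma>"
    have f: "singular_simplex (Suc n) X (?f k)" if "k \<le> Suc (Suc n)" for k
      using singular_simplex_singular_face [OF True _ that] by simp
    have "chain_boundary (Suc n) (chain_boundary (Suc (Suc n)) (frag_of \<sigma>)) = 0"
      using True by (intro chain_boundary_boundary_alt [of _ X]) (simp add: singular_chain_of)
    moreover have "chain_boundary (Suc n) (chain_boundary (Suc (Suc n)) (frag_of \<sigma>))
      = (\<Sum>k\<le>Suc (Suc n). frag_cmul ((-1) ^ k) (chain_boundary (Suc n) (frag_of (?f k))))"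
      unfolding chain_boundary_of [of "Suc (Suc n)"]
      by (simp only: chain_boundary_sum chain_boundary_cmul o_def nat.simps if_False)
    ultimately have "cochain_eval \<phi>
        (\<Sum>k\<le>Suc (Suc n). frag_cmul ((-1) ^ k) (chain_boundary (Suc n) (frag_of (?f k)))) = 0"
      by (metis cochain_eval_0)
    then have "(\<Sum>k\<le>Suc (Suc n).
        (-1) ^ k * cochain_eval \<phi> (chain_boundary (Suc n) (frag_of (?f k)))) = 0"
      by (simp only: cochain_eval_sum cochain_eval_cmul of_int_power of_int_minus of_int_1)
    moreover have "(\<Sum>k\<le>Suc (Suc n). (-1) ^ k * coboundary n X \<phi> (?f k)) =
       (\<Sum>k\<le>Suc (Suc n). (-1) ^ k * cochain_eval \<phi> (chain_boundary (Suc n) (frag_of (?f k))))"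
      by (rule sum.cong) (simp_all only: coboundary_def f atMost_iff if_True)
    ultimately show ?thesis
      by (simp only: coboundary_simplex [OF True])
  qed (simp add: coboundary_nonsimplex)
qed

lemma coboundary_in_relcochain_set:
  assumes "\<phi> \<in> relcochain_set n X A"
  shows "coboundary n X \<phi> \<in> relcochain_set (Suc n) X A"
proof -
  have "coboundary n X \<phi> \<sigma> = 0" if s: "singular_simplex (Suc n) (subtopology X A) \<sigma>" for \<sigma>
  proof -
    have "singular_simplex n (subtopology X A) (singular_face (Suc n) k \<sigma>)" if "k \<le> Suc n" for k
      using singular_simplex_singular_face [OF s _ that] by simp
    then have "\<phi> (singular_face (Suc n) k \<sigma>) = 0" if "k \<le> Suc n" for k
      using assms that unfolding relcochain_set_def by blast
    moreover have "singular_simplex (Suc n) X \<sigma>"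
      using s by (simp add: singular_simplex_subtopology)
    ultimately show ?thesis
      by (simp add: coboundary_simplex)
  qed
  then show ?thesis
    by (simp add: relcochain_set_def coboundary_nonsimplex)
qed

lemma relcocycle_setD: "\<phi> \<in> relcocycle_set n X A \<Longrightarrow> \<phi> \<in> relcochain_set n X A"
  by (simp add: relcocycle_set_def)

lemma relcoboundary_set_subset: "relcoboundary_set n X A \<subseteq> relcocycle_set n X A"
proof (cases n)
  case 0
  then show ?thesis
    by (simp add: relcoboundary_set_def relcocycle_set_def relcochain_set_def coboundary_zero)
next
  case (Suc m)
  then show ?thesis
    by (auto simp: relcoboundary_set_def relcocycle_set_def coboundary_in_relcochain_set
        coboundary_coboundary)
qed

lemma relcochain_set_add:
  "\<lbrakk>\<phi> \<in> relcochain_set n X A; \<psi> \<in> relcochain_set n X A\<rbrakk>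
     \<Longrightarrow> (\<lambda>\<sigma>. \<phi> \<sigma> + \<psi> \<sigma>) \<in> relcochain_set n X A"
  by (simp add: relcochain_set_def)

lemma relcochain_set_cmul:
  "\<phi> \<in> relcochain_set n X A \<Longrightarrow> (\<lambda>\<sigma>. a * \<phi> \<sigma>) \<in> relcochain_set n X A"
  by (simp add: relcochain_set_def)

lemma relcoboundary_set_add:
  assumes "\<phi> \<in> relcoboundary_set n X A" "\<psi> \<in> relcoboundary_set n X A"
  shows "(\<lambda>\<sigma>. \<phi> \<sigma> + \<psi> \<sigma>) \<in> relcoboundary_set n X A"
proof (cases n)
  case 0
  with assms show ?thesis by (simp add: relcoboundary_set_def)
next
  case (Suc m)
  with assms obtain \<alpha> \<beta> where "\<alpha> \<in> relcochain_set m X A" "\<beta> \<in> relcochain_set m X A"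
    "\<phi> = coboundary m X \<alpha>" "\<psi> = coboundary m X \<beta>"
    by (auto simp: relcoboundary_set_def)
  then have "(\<lambda>\<sigma>. \<phi> \<sigma> + \<psi> \<sigma>) = coboundary m X (\<lambda>\<sigma>. \<alpha> \<sigma> + \<beta> \<sigma>)"
    "(\<lambda>\<sigma>. \<alpha> \<sigma> + \<beta> \<sigma>) \<in> relcochain_set m X A"
    by (simp_all only: coboundary_add relcochain_set_add)
  then show ?thesis
    by (simp only: relcoboundary_set_def Suc nat.case image_eqI)
qed

lemma relcoboundary_set_cmul:
  assumes "\<phi> \<in> relcoboundary_set n X A"
  shows "(\<lambda>\<sigma>. a * \<phi> \<sigma>) \<in> relcoboundary_set n X A"
proof (cases n)
  case 0
  with assms show ?thesis by (simp add: relcoboundary_set_def)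
next
  case (Suc m)
  with assms obtain \<alpha> where "\<alpha> \<in> relcochain_set m X A" "\<phi> = coboundary m X \<alpha>"
    by (auto simp: relcoboundary_set_def)
  then have "(\<lambda>\<sigma>. a * \<phi> \<sigma>) = coboundary m X (\<lambda>\<sigma>. a * \<alpha> \<sigma>)"
    "(\<lambda>\<sigma>. a * \<alpha> \<sigma>) \<in> relcochain_set m X A"
    by (simp_all only: coboundary_cmul relcochain_set_cmul)
  then show ?thesis
    by (simp only: relcoboundary_set_def Suc nat.case image_eqI)
qed

lemma relcoboundary_set_minus:
  "\<phi> \<in> relcoboundary_set n X A \<Longrightarrow> (\<lambda>\<sigma>. - \<phi> \<sigma>) \<in> relcoboundary_set n X A"
  using relcoboundary_set_cmul [of \<phi> n X A "-1"] by simp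

lemma zero_in_relcoboundary_set: "(\<lambda>_. 0) \<in> relcoboundary_set n X A"
proof (cases n)
  case (Suc m)
  have z: "(\<lambda>_. 0) \<in> relcochain_set m X A" by (simp add: relcochain_set_def)
  show ?thesis
    unfolding relcoboundary_set_def Suc nat.case
    by (rule image_eqI [of _ _ "\<lambda>_. 0"]) (simp_all only: coboundary_zero z)
qed (simp add: relcoboundary_set_def)

lemma relcocycle_set_add:
  "\<lbrakk>\<phi> \<in> relcocycle_set n X A; \<psi> \<in> relcocycle_set n X A\<rbrakk>
     \<Longrightarrow> (\<lambda>\<sigma>. \<phi> \<sigma> + \<psi> \<sigma>) \<in> relcocycle_set n X A"
  by (simp add: relcocycle_set_def relcochain_set_add coboundary_add)

lemma relcocycle_set_minus:
  "\<phi> \<in> relcocycle_set n X A \<Longrightarrow> (\<lambda>\<sigma>. - \<phi> \<sigma>) \<in> relcocycle_set n X A"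
  using relcochain_set_cmul [of \<phi> n X A "-1"]
  by (simp add: relcocycle_set_def coboundary_minus)

lemma comm_group_relcocycle_group: "comm_group (relcocycle_group n X A)"
proof (rule comm_groupI)
  have "(\<lambda>_. 0) \<in> relcocycle_set n X A"
    using zero_in_relcoboundary_set relcoboundary_set_subset by blast
  then show "\<one>\<^bsub>relcocycle_group n X A\<^esub> \<in> carrier (relcocycle_group n X A)"
    by (simp add: relcocycle_group_def)
  show "\<exists>\<psi>\<in>carrier (relcocycle_group n X A).
      \<psi> \<otimes>\<^bsub>relcocycle_group n X A\<^esub> \<phi> = \<one>\<^bsub>relcocycle_group n X A\<^esub>"
    if "\<phi> \<in> carrier (relcocycle_group n X A)" for \<phi>
    using that relcocycle_set_minus [of \<phi> n X A]
    by (intro bexI [of _ "\<lambda>\<sigma>. - \<phi> \<sigma>"]) (simp_all add: relcocycle_group_def)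
qed (simp_all add: relcocycle_group_def relcocycle_set_add ac_simps)

lemma inv_relcocycle_group:
  assumes "\<phi> \<in> relcocycle_set n X A"
  shows "inv\<^bsub>relcocycle_group n X A\<^esub> \<phi> = (\<lambda>\<sigma>. - \<phi> \<sigma>)"
proof -
  interpret comm_group "relcocycle_group n X A" by (rule comm_group_relcocycle_group)
  show ?thesis
    by (rule inv_equality)
       (use assms relcocycle_set_minus [OF assms] in \<open>simp_all add: relcocycle_group_def\<close>)
qed

lemma subgroup_relcoboundary_set:
  "subgroup (relcoboundary_set n X A) (relcocycle_group n X A)"
proof
  show "relcoboundary_set n X A \<subseteq> carrier (relcocycle_group n X A)"
    using relcoboundary_set_subset by (simp add: relcocycle_group_def)
  show "inv\<^bsub>relcocycle_group n X A\<^esub> \<phi> \<in> relcoboundary_set n X A"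
    if "\<phi> \<in> relcoboundary_set n X A" for \<phi>
  proof -
    have "\<phi> \<in> relcocycle_set n X A" using that relcoboundary_set_subset by blast
    then show ?thesis using that by (simp add: inv_relcocycle_group relcoboundary_set_minus)
  qed
qed (simp_all add: relcocycle_group_def relcoboundary_set_add zero_in_relcoboundary_set)

lemma comm_group_relative_cohomology_group: "comm_group (relative_cohomology_group n X A)"
  unfolding relative_cohomology_group_def
  by (intro comm_group.abelian_FactGroup comm_group_relcocycle_group subgroup_relcoboundary_set)

lemma carrier_relative_cohomology_group:
  "carrier (relative_cohomology_group n X A) = cohomology_class n X A ` relcocycle_set n X A"
  by (auto simp: relative_cohomology_group_def carrier_FactGroup cohomology_class_def
      relcocycle_group_def)

lemma one_relative_cohomology_group:
  "\<one>\<^bsub>relative_cohomology_group n X A\<^esub> = relcoboundary_set n X A"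
  by (simp add: relative_cohomology_group_def)

lemma carrier_relative_cohomology:
  "carrier (relative_cohomology X A) =
     {v. (\<forall>n. v n \<in> carrier (relative_cohomology_group n X A)) \<and>
         finite {n. v n \<noteq> \<one>\<^bsub>relative_cohomology_group n X A\<^esub>}}"
proof -
  have "group (relative_cohomology_group n X A)" for n
    using comm_group_relative_cohomology_group comm_group.axioms(2) by blast
  then have "carrier (relative_cohomology X A) =
     {v \<in> \<Pi>\<^sub>E n\<in>UNIV. carrier (relative_cohomology_group n X A).
         finite {n \<in> UNIV. v n \<noteq> \<one>\<^bsub>relative_cohomology_group n X A\<^esub>}}"
    unfolding relative_cohomology_def by (rule carrier_sum_group)
  then show ?thesis
    by (simp add: PiE_iff)
qed

lemma cohomology_class_iff:
  "\<psi> \<in> cohomology_class n X A \<phi> \<longleftrightarrow> (\<lambda>\<sigma>. \<psi> \<sigma> - \<phi> \<sigma>) \<in> relcoboundary_set n X A"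
proof
  assume "\<psi> \<in> cohomology_class n X A \<phi>"
  then show "(\<lambda>\<sigma>. \<psi> \<sigma> - \<phi> \<sigma>) \<in> relcoboundary_set n X A"
    by (auto simp: cohomology_class_def r_coset_def relcocycle_group_def)
next
  assume *: "(\<lambda>\<sigma>. \<psi> \<sigma> - \<phi> \<sigma>) \<in> relcoboundary_set n X A"
  have "\<psi> = (\<lambda>\<sigma>. \<psi> \<sigma> - \<phi> \<sigma>) \<otimes>\<^bsub>relcocycle_group n X A\<^esub> \<phi>"
    by (simp add: relcocycle_group_def)
  with * show "\<psi> \<in> cohomology_class n X A \<phi>"
    unfolding cohomology_class_def r_coset_def by blast
qed

lemma cohomology_class_eqI:
  assumes "(\<lambda>\<sigma>. \<phi> \<sigma> - \<psi> \<sigma>) \<in> relcoboundary_set n X A"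
  shows "cohomology_class n X A \<phi> = cohomology_class n X A \<psi>"
proof -
  have "(\<lambda>\<sigma>. \<theta> \<sigma> - \<psi> \<sigma>) \<in> relcoboundary_set n X A"
    if "(\<lambda>\<sigma>. \<theta> \<sigma> - \<phi> \<sigma>) \<in> relcoboundary_set n X A" for \<theta>
    using relcoboundary_set_add [OF that assms] by simp
  moreover have "(\<lambda>\<sigma>. \<theta> \<sigma> - \<phi> \<sigma>) \<in> relcoboundary_set n X A"
    if "(\<lambda>\<sigma>. \<theta> \<sigma> - \<psi> \<sigma>) \<in> relcoboundary_set n X A" for \<theta>
    using relcoboundary_set_add [OF that relcoboundary_set_minus [OF assms]] by simp
  ultimately show ?thesis
    unfolding set_eq_iff cohomology_class_iff by blast
qed


subsection \<open>Cup products\<close>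

text \<open>The faces of a \<open>(p + q)\<close>-simplex spanned by its first \<open>p + 1\<close> and its last \<open>q + 1\<close>
  vertices.\<close>

definition front_face :: "nat \<Rightarrow> ((nat \<Rightarrow> real) \<Rightarrow> 'a) \<Rightarrow> (nat \<Rightarrow> real) \<Rightarrow> 'a" where
  "front_face p \<sigma> = restrict \<sigma> (standard_simplex p)"

definition back_face :: "nat \<Rightarrow> nat \<Rightarrow> ((nat \<Rightarrow> real) \<Rightarrow> 'a) \<Rightarrow> (nat \<Rightarrow> real) \<Rightarrow> 'a" where
  "back_face p q \<sigma> = (\<lambda>x\<in>standard_simplex q. \<sigma> (\<lambda>i. if i < p then 0 else x (i - p)))"

definition cup_cochain ::
    "nat \<Rightarrow> nat \<Rightarrow> 'a topology \<Rightarrow> ('a, 'r::comm_ring_1) cochain \<Rightarrow> ('a, 'r) cochain \<Rightarrow> ('a, 'r) cochain"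
  where
  "cup_cochain p q X \<phi> \<psi> =
     (\<lambda>\<sigma>. if singular_simplex (p + q) X \<sigma> then \<phi> (front_face p \<sigma>) * \<psi> (back_face p q \<sigma>) else 0)"

text \<open>The union is over a family with a single member, since the class of a product of cocycles
  depends only on their classes: see \<open>cup_class_cohomology_class\<close> below.\<close>

definition cup_class ::
    "nat \<Rightarrow> nat \<Rightarrow> 'a topology \<Rightarrow> 'a set \<Rightarrow>
     ('a, 'r::comm_ring_1) cochain set \<Rightarrow> ('a, 'r) cochain set \<Rightarrow> ('a, 'r) cochain set" where
  "cup_class p q X A a b =
     (\<Union>\<phi>\<in>a. \<Union>\<psi>\<in>b. cohomology_class (p + q) X A (cup_cochain p q X \<phi> \<psi>))"

lemma back_vertices_in_standard_simplex:
  assumes "x \<in> standard_simplex q"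
  shows "(\<lambda>i. if i < p then 0 else x (i - p)) \<in> standard_simplex (p + q)"
proof -
  have "(\<Sum>i\<le>p + q. if i < p then 0 else x (i - p)) = (\<Sum>i\<in>{p..p + q}. x (i - p))"
    by (rule sum.mono_neutral_cong_right) auto
  also have "\<dots> = (\<Sum>i\<le>q. x i)"
    by (rule sum.reindex_bij_witness [of _ "\<lambda>i. i + p" "\<lambda>i. i - p"]) auto
  finally show ?thesis
    using assms by (auto simp: standard_simplex_def)
qed

lemma singular_simplex_front_face:
  assumes "singular_simplex (p + q) X \<sigma>"
  shows "singular_simplex p X (front_face p \<sigma>)"
proof -
  have "continuous_map (subtopology (powertop_real UNIV) (standard_simplex p)) X \<sigma>"
    using assms standard_simplex_mono [of p "p + q"]
    by (auto simp: singular_simplex_def intro: continuous_map_from_subtopology_mono)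
  then have "continuous_map (subtopology (powertop_real UNIV) (standard_simplex p)) X (front_face p \<sigma>)"
    by (rule continuous_map_eq) (simp add: front_face_def)
  then show ?thesis
    by (simp add: singular_simplex_def front_face_def)
qed

lemma singular_simplex_back_face:
  assumes "singular_simplex (p + q) X \<sigma>"
  shows "singular_simplex q X (back_face p q \<sigma>)"
proof -
  let ?b = "\<lambda>x i. if i < p then 0 else x (i - p)"
  have "continuous_map (powertop_real UNIV) euclideanreal (\<lambda>x. ?b x i)" for i
    by (cases "i < p") (auto intro: continuous_map_product_projection)
  then have "continuous_map (subtopology (powertop_real UNIV) (standard_simplex q))
               (subtopology (powertop_real UNIV) (standard_simplex (p + q))) ?b"
    using back_vertices_in_standard_simplex
    by (auto simp: continuous_map_in_subtopology continuous_map_componentwise_UNIV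
        continuous_map_from_subtopology)
  then have "continuous_map (subtopology (powertop_real UNIV) (standard_simplex q)) X (\<sigma> \<circ> ?b)"
    using assms continuous_map_compose by (force simp: singular_simplex_def)
  then have "continuous_map (subtopology (powertop_real UNIV) (standard_simplex q)) X (back_face p q \<sigma>)"
    by (rule continuous_map_eq) (simp add: back_face_def)
  then show ?thesis
    by (simp add: singular_simplex_def back_face_def)
qed

lemma front_face_singular_face_low:
  assumes "k \<le> p"
  shows "front_face p (singular_face (Suc (p + q)) k \<sigma>) =
         singular_face (Suc p) k (front_face (Suc p) \<sigma>)"
proof
  fix x
  show "front_face p (singular_face (Suc (p + q)) k \<sigma>) x =
         singular_face (Suc p) k (front_face (Suc p) \<sigma>) x"
    using standard_simplex_mono [of p "p + q"] assms
      simplical_face_in_standard_simplex [of "Suc p" k x]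
    by (auto simp: front_face_def singular_face_def restrict_def)
qed

lemma front_face_singular_face_high:
  assumes "p < k"
  shows "front_face p (singular_face (Suc (p + q)) k \<sigma>) = front_face p \<sigma>"
proof
  fix x
  have "simplical_face k x = x" if "x \<in> standard_simplex p"
    using that assms by (auto simp: simplical_face_def standard_simplex_def fun_eq_iff)
  then show "front_face p (singular_face (Suc (p + q)) k \<sigma>) x = front_face p \<sigma> x"
    using standard_simplex_mono [of p "p + q"]
    by (auto simp: front_face_def singular_face_def restrict_def)
qed

lemma back_face_singular_face_low:
  assumes "k \<le> p"
  shows "back_face p q (singular_face (Suc (p + q)) k \<sigma>) = back_face (Suc p) q \<sigma>"
proof
  fix x :: "nat \<Rightarrow> real"
  have "simplical_face k (\<lambda>i. if i < p then 0 else x (i - p)) =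
        (\<lambda>i. if i < Suc p then 0 else x (i - Suc p))"
    using assms by (auto simp: simplical_face_def fun_eq_iff)
  then show "back_face p q (singular_face (Suc (p + q)) k \<sigma>) x = back_face (Suc p) q \<sigma> x"
    using back_vertices_in_standard_simplex [of x q p]
    by (auto simp: back_face_def singular_face_def restrict_def)
qed

lemma back_face_singular_face_high:
  assumes "k \<le> Suc q"
  shows "back_face p q (singular_face (Suc (p + q)) (p + k) \<sigma>) =
         singular_face (Suc q) k (back_face p (Suc q) \<sigma>)"
proof
  fix x :: "nat \<Rightarrow> real"
  have "simplical_face (p + k) (\<lambda>i. if i < p then 0 else x (i - p)) =
        (\<lambda>i. if i < p then 0 else simplical_face k x (i - p))"
    by (auto simp: simplical_face_def fun_eq_iff)
  then show "back_face p q (singular_face (Suc (p + q)) (p + k) \<sigma>) x =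
         singular_face (Suc q) k (back_face p (Suc q) \<sigma>) x"
    using back_vertices_in_standard_simplex [of x q p] assms
      simplical_face_in_standard_simplex [of "Suc q" k x]
    by (auto simp: back_face_def singular_face_def restrict_def)
qed

lemma coboundary_cup_cochain:
  "coboundary (p + q) X (cup_cochain p q X \<phi> \<psi>) =
     (\<lambda>\<sigma>. cup_cochain (Suc p) q X (coboundary p X \<phi>) \<psi> \<sigma> +
          (-1) ^ p * cup_cochain p (Suc q) X \<phi> (coboundary q X \<psi>) \<sigma>)"
proof
  fix \<sigma>
  show "coboundary (p + q) X (cup_cochain p q X \<phi> \<psi>) \<sigma> =
     cup_cochain (Suc p) q X (coboundary p X \<phi>) \<psi> \<sigma> +
     (-1) ^ p * cup_cochain p (Suc q) X \<phi> (coboundary q X \<psi>) \<sigma>"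
  proof (cases "singular_simplex (Suc (p + q)) X \<sigma>")
    case True
    let ?d = "\<lambda>k. singular_face (Suc (p + q)) k \<sigma>"
    define F where "F = (\<lambda>k. \<phi> (singular_face (Suc p) k (front_face (Suc p) \<sigma>)))"
    define G where "G = (\<lambda>k. \<psi> (singular_face (Suc q) k (back_face p (Suc q) \<sigma>)))"
    define f where "f = \<phi> (front_face p \<sigma>)"
    define g where "g = \<psi> (back_face (Suc p) q \<sigma>)"
    have d: "singular_simplex (p + q) X (?d k)" if "k \<le> Suc (p + q)" for k
      using singular_simplex_singular_face [OF True _ that] by simp
    have Fp: "F (Suc p) = f"
    proof -
      have "simplical_face (Suc p) x = x" if "x \<in> standard_simplex p" for x :: "nat \<Rightarrow> real"
        using that by (auto simp: simplical_face_def standard_simplex_def fun_eq_iff)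
      moreover have "standard_simplex p \<subseteq> standard_simplex (Suc p)"
        by (simp add: standard_simplex_mono)
      ultimately have "singular_face (Suc p) (Suc p) (front_face (Suc p) \<sigma>) = front_face p \<sigma>"
        by (intro ext) (auto simp: front_face_def singular_face_def restrict_def)
      then show ?thesis by (simp add: F_def f_def)
    qed
    have G0: "G 0 = g"
      using back_face_singular_face_low [of p p q \<sigma>] back_face_singular_face_high [of 0 q p \<sigma>]
      by (simp add: G_def g_def)
    have "coboundary (p + q) X (cup_cochain p q X \<phi> \<psi>) \<sigma> =
        (\<Sum>k\<le>Suc (p + q). (-1) ^ k * (\<phi> (front_face p (?d k)) * \<psi> (back_face p q (?d k))))"
      unfolding coboundary_simplex [OF True] using d by (intro sum.cong) (auto simp: cup_cochain_def)
    also have "\<dots> = (\<Sum>k\<in>{..p}. (-1) ^ k * (\<phi> (front_face p (?d k)) * \<psi> (back_face p q (?d k))))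
        + (\<Sum>k\<in>{Suc p..Suc (p + q)}. (-1) ^ k * (\<phi> (front_face p (?d k)) * \<psi> (back_face p q (?d k))))"
    proof -
      have "{..Suc (p + q)} = {..p} \<union> {Suc p..Suc (p + q)}" by auto
      then show ?thesis by (simp only:) (rule sum.union_disjoint, auto)
    qed
    also have "(\<Sum>k\<in>{..p}. (-1) ^ k * (\<phi> (front_face p (?d k)) * \<psi> (back_face p q (?d k))))
        = (\<Sum>k\<le>p. (-1) ^ k * F k) * g"
      unfolding sum_distrib_right F_def g_def
      by (rule sum.cong) (simp_all add: front_face_singular_face_low back_face_singular_face_low mult.assoc)
    also have "(\<Sum>k\<in>{Suc p..Suc (p + q)}. (-1) ^ k * (\<phi> (front_face p (?d k)) * \<psi> (back_face p q (?d k))))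
        = (\<Sum>k\<in>{1..Suc q}. (-1) ^ (p + k) * (\<phi> (front_face p (?d (p + k))) * \<psi> (back_face p q (?d (p + k)))))"
      by (rule sum.reindex_bij_witness [of _ "\<lambda>k. p + k" "\<lambda>k. k - p"]) auto
    also have "\<dots> = (-1) ^ p * (f * (\<Sum>k\<in>{1..Suc q}. (-1) ^ k * G k))"
      unfolding sum_distrib_left f_def G_def
      by (rule sum.cong)
         (simp_all add: front_face_singular_face_high back_face_singular_face_high power_add mult_ac)
    finally have L: "coboundary (p + q) X (cup_cochain p q X \<phi> \<psi>) \<sigma> =
       (\<Sum>k\<le>p. (-1) ^ k * F k) * g + (-1) ^ p * (f * (\<Sum>k\<in>{1..Suc q}. (-1) ^ k * G k))" .
    have ff: "singular_simplex (Suc p) X (front_face (Suc p) \<sigma>)"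
      using True singular_simplex_front_face [of "Suc p" q X \<sigma>] by simp
    have bb: "singular_simplex (Suc q) X (back_face p (Suc q) \<sigma>)"
      using True singular_simplex_back_face [of p "Suc q" X \<sigma>] by simp
    have "cup_cochain (Suc p) q X (coboundary p X \<phi>) \<psi> \<sigma> =
        ((\<Sum>k\<le>p. (-1) ^ k * F k) + (-1) ^ Suc p * f) * g"
      using True Fp unfolding cup_cochain_def coboundary_simplex [OF ff]
      by (simp add: F_def g_def)
    moreover have "cup_cochain p (Suc q) X \<phi> (coboundary q X \<psi>) \<sigma> =
        f * (\<Sum>k\<le>Suc q. (-1) ^ k * G k)"
      using True unfolding cup_cochain_def coboundary_simplex [OF bb]
      by (simp add: G_def f_def)
    moreover have "(\<Sum>k\<le>Suc q. (-1) ^ k * G k) = g + (\<Sum>k\<in>{1..Suc q}. (-1) ^ k * G k)"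
    proof -
      have "{..Suc q} = insert 0 {1..Suc q}" by auto
      then show ?thesis using G0 by simp
    qed
    ultimately show ?thesis
      unfolding L by (simp add: algebra_simps del: sum.atMost_Suc sum.cl_ivl_Suc)
  next
    case False
    then show ?thesis by (simp add: coboundary_nonsimplex cup_cochain_def)
  qed
qed

lemma cup_cochain_in_relcochain_set:
  assumes "\<phi> \<in> relcochain_set p X A"
  shows "cup_cochain p q X \<phi> \<psi> \<in> relcochain_set (p + q) X A"
  using assms singular_simplex_front_face [of p q "subtopology X A"]
  by (auto simp: relcochain_set_def cup_cochain_def)

lemma cup_cochain_in_relcocycle_set:
  assumes "\<phi> \<in> relcocycle_set p X A" "\<psi> \<in> relcocycle_set q X A"
  shows "cup_cochain p q X \<phi> \<psi> \<in> relcocycle_set (p + q) X A"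
proof -
  have "coboundary p X \<phi> = (\<lambda>_. 0)" "coboundary q X \<psi> = (\<lambda>_. 0)"
    using assms by (simp_all add: relcocycle_set_def)
  then have "coboundary (p + q) X (cup_cochain p q X \<phi> \<psi>) = (\<lambda>_. 0)"
    unfolding coboundary_cup_cochain by (simp add: cup_cochain_def fun_eq_iff)
  then show ?thesis
    using assms cup_cochain_in_relcochain_set [of \<phi> p X A q \<psi>]
    by (simp add: relcocycle_set_def)
qed

lemma cup_cochain_relcoboundary_left:
  assumes "\<phi> \<in> relcoboundary_set p X A" "\<psi> \<in> relcocycle_set q X A"
  shows "cup_cochain p q X \<phi> \<psi> \<in> relcoboundary_set (p + q) X A"
proof (cases p)
  case 0
  then have "cup_cochain p q X \<phi> \<psi> = (\<lambda>_. 0)"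
    using assms by (auto simp: relcoboundary_set_def cup_cochain_def)
  then show ?thesis by (simp add: zero_in_relcoboundary_set)
next
  case (Suc m)
  then obtain \<alpha> where a: "\<alpha> \<in> relcochain_set m X A" "\<phi> = coboundary m X \<alpha>"
    using assms by (auto simp: relcoboundary_set_def)
  have "coboundary q X \<psi> = (\<lambda>_. 0)" using assms by (simp add: relcocycle_set_def)
  then have "cup_cochain p q X \<phi> \<psi> = coboundary (m + q) X (cup_cochain m q X \<alpha> \<psi>)"
    unfolding coboundary_cup_cochain by (simp add: a Suc cup_cochain_def fun_eq_iff)
  then show ?thesis
    using cup_cochain_in_relcochain_set [OF a(1), of q \<psi>] Suc by (simp add: relcoboundary_set_def)
qed

lemma cup_cochain_relcoboundary_right:
  assumes "\<phi> \<in> relcocycle_set p X A" "\<psi> \<in> relcoboundary_set q X A"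
  shows "cup_cochain p q X \<phi> \<psi> \<in> relcoboundary_set (p + q) X A"
proof (cases q)
  case 0
  then have "cup_cochain p q X \<phi> \<psi> = (\<lambda>_. 0)"
    using assms by (auto simp: relcoboundary_set_def cup_cochain_def)
  then show ?thesis by (simp add: zero_in_relcoboundary_set)
next
  case (Suc m)
  then obtain \<beta> where b: "\<beta> \<in> relcochain_set m X A" "\<psi> = coboundary m X \<beta>"
    using assms by (auto simp: relcoboundary_set_def)
  have 1: "coboundary p X \<phi> = (\<lambda>_. 0)" using assms by (simp add: relcocycle_set_def)
  have "coboundary (p + m) X (cup_cochain p m X \<phi> \<beta>) = (\<lambda>\<sigma>. (-1) ^ p * cup_cochain p q X \<phi> \<psi> \<sigma>)"
    unfolding coboundary_cup_cochain 1 by (simp add: b Suc cup_cochain_def fun_eq_iff)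
  moreover have "coboundary (p + m) X (cup_cochain p m X \<phi> \<beta>) \<in> relcoboundary_set (p + q) X A"
    using cup_cochain_in_relcochain_set [OF relcocycle_setD [OF assms(1)], of m \<beta>] Suc
    by (simp add: relcoboundary_set_def)
  ultimately have "(\<lambda>\<sigma>. (-1) ^ p * ((-1) ^ p * cup_cochain p q X \<phi> \<psi> \<sigma>)) \<in> relcoboundary_set (p + q) X A"
    using relcoboundary_set_cmul [of _ "p + q" X A "(-1) ^ p"] by metis
  moreover have "(-1) ^ p * ((-1) ^ p * r) = r" for r :: 'b
    by (simp add: mult.assoc [symmetric] power_add [symmetric])
  ultimately show ?thesis by simp
qed

lemma cup_class_cohomology_class:
  assumes \<phi>: "\<phi> \<in> relcocycle_set p X A" and \<psi>: "\<psi> \<in> relcocycle_set q X A"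
  shows "cup_class p q X A (cohomology_class p X A \<phi>) (cohomology_class q X A \<psi>) =
         cohomology_class (p + q) X A (cup_cochain p q X \<phi> \<psi>)"
proof -
  have "cohomology_class (p + q) X A (cup_cochain p q X \<phi>' \<psi>') =
        cohomology_class (p + q) X A (cup_cochain p q X \<phi> \<psi>)"
    if "\<phi>' \<in> cohomology_class p X A \<phi>" "\<psi>' \<in> cohomology_class q X A \<psi>" for \<phi>' \<psi>'
  proof (rule cohomology_class_eqI)
    have a: "(\<lambda>\<sigma>. \<phi>' \<sigma> - \<phi> \<sigma>) \<in> relcoboundary_set p X A"
      and b: "(\<lambda>\<sigma>. \<psi>' \<sigma> - \<psi> \<sigma>) \<in> relcoboundary_set q X A"
      using that by (simp_all add: cohomology_class_iff)
    have "(\<lambda>\<sigma>. \<psi>' \<sigma> - \<psi> \<sigma>) \<in> relcocycle_set q X A"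
      using b relcoboundary_set_subset by blast
    from relcocycle_set_add [OF this \<psi>] have \<psi>': "\<psi>' \<in> relcocycle_set q X A" by simp
    have "(\<lambda>\<sigma>. cup_cochain p q X \<phi>' \<psi>' \<sigma> - cup_cochain p q X \<phi> \<psi> \<sigma>) =
       (\<lambda>\<sigma>. cup_cochain p q X (\<lambda>\<sigma>. \<phi>' \<sigma> - \<phi> \<sigma>) \<psi>' \<sigma> + cup_cochain p q X \<phi> (\<lambda>\<sigma>. \<psi>' \<sigma> - \<psi> \<sigma>) \<sigma>)"
      by (rule ext) (simp add: cup_cochain_def algebra_simps)
    then show "(\<lambda>\<sigma>. cup_cochain p q X \<phi>' \<psi>' \<sigma> - cup_cochain p q X \<phi> \<psi> \<sigma>)
        \<in> relcoboundary_set (p + q) X A"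
      using relcoboundary_set_add [OF cup_cochain_relcoboundary_left [OF a \<psi>']
          cup_cochain_relcoboundary_right [OF \<phi> b]] by simp
  qed
  moreover have "\<phi> \<in> cohomology_class p X A \<phi>" "\<psi> \<in> cohomology_class q X A \<psi>"
    by (simp_all add: cohomology_class_iff zero_in_relcoboundary_set)
  ultimately show ?thesis
    unfolding cup_class_def by blast
qed

text \<open>Since the groups are written multiplicatively, the \<^const>\<open>finprod\<close> below is the sum
  \<open>\<Sum>\<^sub>i v\<^sub>i \<smile> w\<^sub>n\<^sub>-\<^sub>i\<close> in \<open>H\<^sup>n(X, A)\<close>.\<close>

definition cup ::
    "'a topology \<Rightarrow> 'a set \<Rightarrow> (nat \<Rightarrow> ('a, 'r::comm_ring_1) cochain set) \<Rightarrow>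
     (nat \<Rightarrow> ('a, 'r) cochain set) \<Rightarrow> nat \<Rightarrow> ('a, 'r) cochain set" where
  "cup X A v w =
     (\<lambda>n. finprod (relative_cohomology_group n X A)
            (\<lambda>i. cup_class i (n - i) X A (v i) (w (n - i))) {..n})"

end

theory Submission
  imports Defs
begin

text \<open>Let \<open>U\<close> be an invariant domain with equivariant section \<open>\<sigma>\<close>. Contracting each path \<open>\<sigma>(z)\<close> from
  both ends to its midpoint is an equivariant homotopy, so it descends to a homotopy that deforms
  \<open>\<rho>(U)\<close> inside \<open>SP\<^sup>2\<^sub>B(E)\<close> into \<open>dE\<^sub>B\<close> and fixes \<open>dE\<^sub>B\<close> pointwise. Hence every cocycle relative
  to \<open>dE\<^sub>B\<close> is cohomologous to one that vanishes on \<open>\<rho>(U)\<close>. If the images of \<open>k\<close> such domains cover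
  \<open>SP\<^sup>2\<^sub>B(E)\<close>, then a product of \<open>k\<close> classes is represented by a cocycle that vanishes on every simplex
  contained in one member of this open cover, and barycentric subdivision makes it a coboundary.\<close>


subsection \<open>Deformations into the subspace\<close>

text \<open>The codegeneracy in barycentric coordinates: the affine map of simplices that collapses
  the edge from vertex \<open>i\<close> to vertex \<open>i + 1\<close>. No dimension occurs in it,
  so one function serves all \<open>q\<close>.\<close>

definition degeneracy :: "nat \<Rightarrow> (nat \<Rightarrow> real) \<Rightarrow> nat \<Rightarrow> real" where
  "degeneracy i x = (\<lambda>m. if m < i then x m else if m = i then x m + x (Suc m) else x (Suc m))"

text \<open>For \<open>F = id\<close> this is the \<open>i\<close>-th simplex of the standard triangulation of \<open>\<Delta>\<^sup>q \<times> I\<close>: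
  the vertices up to \<open>i\<close> lie over \<open>0\<close>, the later ones over \<open>1\<close>.\<close>

definition prism_simplex ::
    "nat \<Rightarrow> ('a \<times> real \<Rightarrow> 'b) \<Rightarrow> nat \<Rightarrow> ((nat \<Rightarrow> real) \<Rightarrow> 'a) \<Rightarrow> (nat \<Rightarrow> real) \<Rightarrow> 'b" where
  "prism_simplex q F i \<sigma> =
     (\<lambda>x\<in>standard_simplex (Suc q). F (\<sigma> (degeneracy i x), 1 - sum x {..i}))"

section \<open>Prism simplices as singular simplices\<close>

lemma degeneracy_in_standard_simplex:
  assumes x: "x \<in> standard_simplex (Suc q)" and i: "i \<le> q"
  shows "degeneracy i x \<in> standard_simplex q"
proof -
  \<comment> \<open>Merging two neighbouring coordinates shifts the partial sums from
    \<open>i\<close> on by one index; at \<open>n = q\<close> this gives total weight 1.\<close>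
  have sum: "sum (degeneracy i x) {..n} = sum x {..Suc n}" if "i \<le> n" for n
    using that
  proof (induction n rule: dec_induct)
    case base
    have "sum (degeneracy i x) {..<i} = sum x {..<i}"
      by (rule sum.cong) (simp_all add: degeneracy_def)
    then show ?case
      by (simp add: degeneracy_def flip: lessThan_Suc_atMost)
  qed (simp_all add: degeneracy_def)
  have nonneg: "0 \<le> degeneracy i x m" for m
    using x by (simp add: degeneracy_def standard_simplex_def)
  have 0: "degeneracy i x m = 0" if "q < m" for m
    using x i that by (simp add: degeneracy_def standard_simplex_def)
  have s1: "sum (degeneracy i x) {..q} = 1"
    using x i by (simp add: sum standard_simplex_def del: sum.atMost_Suc)
  have "degeneracy i x m \<le> 1" for m
  proof (cases "m \<le> q")
    case True
    then show ?thesis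
      using member_le_sum [of m "{..q}" "degeneracy i x"] nonneg s1 by simp
  qed (simp add: 0)
  with nonneg 0 s1 show ?thesis by (simp add: standard_simplex_def)
qed

lemma sum_atMost_standard_simplex:
  assumes "x \<in> standard_simplex q"
  shows "sum x {..i} \<in> {0..1}"
proof -
  have nonneg: "\<And>m. 0 \<le> x m" and s1: "sum x {..q} = 1" and z: "\<And>m. q < m \<Longrightarrow> x m = 0"
    using assms by (auto simp: standard_simplex_def)
  have "sum x {..i} = sum x ({..i} \<inter> {..q})"
    by (rule sum.mono_neutral_right) (auto, metis z not_le)
  also have "\<dots> \<le> sum x {..q}"
    by (rule sum_mono2) (auto simp: nonneg)
  finally show ?thesis by (simp add: s1 nonneg sum_nonneg)
qed

lemma continuous_map_degeneracy:
  assumes "\<And>m. continuous_map D euclideanreal (\<lambda>x. x m)"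
  shows "continuous_map D euclideanreal (\<lambda>x. degeneracy i x m)"
proof -
  consider "m < i" | "m = i" | "i < m" by linarith
  then show ?thesis
    by cases (simp_all add: degeneracy_def assms continuous_map_add)
qed

lemma singular_simplex_prism_simplex:
  assumes F: "continuous_map (prod_topology X unit_interval) Y F"
    and \<sigma>: "singular_simplex q X \<sigma>" and i: "i \<le> q"
  shows "singular_simplex (Suc q) Y (prism_simplex q F i \<sigma>)"
proof -
  let ?D = "\<lambda>q. subtopology (powertop_real UNIV) (standard_simplex q)"
  have proj: "continuous_map (?D (Suc q)) euclideanreal (\<lambda>x. x m)" for m
    by (intro continuous_map_from_subtopology continuous_map_product_projection) simp
  have "continuous_map (?D (Suc q)) euclideanreal (\<lambda>x. degeneracy i x m)" for m
    by (rule continuous_map_degeneracy) (rule proj)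
  then have "continuous_map (?D (Suc q)) (?D q) (degeneracy i)"
    using degeneracy_in_standard_simplex [OF _ i]
    by (auto simp: continuous_map_in_subtopology continuous_map_componentwise_UNIV)
  then have 1: "continuous_map (?D (Suc q)) X (\<lambda>x. \<sigma> (degeneracy i x))"
    using \<sigma> continuous_map_compose by (force simp: singular_simplex_def o_def)
  have "continuous_map (?D (Suc q)) euclideanreal (\<lambda>x. 1 - sum x {..i})"
    by (intro continuous_map_diff continuous_map_sum proj) auto
  then have "continuous_map (?D (Suc q)) unit_interval (\<lambda>x. 1 - sum x {..i})"
    using sum_atMost_standard_simplex by (force simp: continuous_map_in_subtopology)
  with 1 have "continuous_map (?D (Suc q)) (prod_topology X unit_interval)
      (\<lambda>x. (\<sigma> (degeneracy i x), 1 - sum x {..i}))"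
    by (simp add: continuous_map_pairwise o_def)
  from continuous_map_compose [OF this F]
  have "continuous_map (?D (Suc q)) Y (prism_simplex q F i \<sigma>)"
    by (rule continuous_map_eq) (simp add: prism_simplex_def)
  then show ?thesis
    by (simp add: singular_simplex_def prism_simplex_def)
qed

section \<open>Faces of the prism simplices\<close>

text \<open>A face map inserts a coordinate 0 at position \<open>j\<close>, so a partial sum that
  reaches \<open>j\<close> contains one coordinate of \<open>x\<close> fewer. These sums determine
  heights in the prism.\<close>

lemma sum_simplical_face:
  fixes x :: "nat \<Rightarrow> real"
  shows "sum (simplical_face j x) {..i} = (if i < j then sum x {..i} else sum x {..<i})"
proof (induction i)
  case (Suc i)
  then show ?case
    by (simp add: simplical_face_def lessThan_Suc_atMost not_less)
       (cases "i < j"; simp flip: lessThan_Suc_atMost)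
qed (simp add: simplical_face_def)

text \<open>The cosimplicial identities between codegeneracies and cofaces.\<close>

lemma degeneracy_simplical_face:
  "j < i \<Longrightarrow> degeneracy i (simplical_face j x) = simplical_face j (degeneracy (i - 1) x)"
  "degeneracy i (simplical_face i x) = x"
  "degeneracy i (simplical_face (Suc i) x) = x"
  "Suc i < j \<Longrightarrow> degeneracy i (simplical_face j x) = simplical_face (j - 1) (degeneracy i x)"
  by (auto simp: degeneracy_def simplical_face_def fun_eq_iff)

text \<open>Face \<open>j\<close> omits a vertex over 0 whose copy over 1 is not in the simplex, so
  it lies in the side wall over the \<open>j\<close>-th face of \<sigma>. One vertex over 0 is gone,
  hence \<open>i - 1\<close>.\<close>

lemma singular_face_prism_simplex_low:
  assumes "j < i" "i \<le> Suc r"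
  shows "singular_face (Suc (Suc r)) j (prism_simplex (Suc r) F i \<sigma>) =
         prism_simplex r F (i - 1) (singular_face (Suc r) j \<sigma>)"
proof
  fix x
  have "x \<in> standard_simplex (Suc r) \<Longrightarrow> simplical_face j x \<in> standard_simplex (Suc (Suc r))"
    using assms simplical_face_in_standard_simplex [of "Suc (Suc r)" j x] by simp
  moreover have "x \<in> standard_simplex (Suc r) \<Longrightarrow> degeneracy (i - 1) x \<in> standard_simplex r"
    using assms by (intro degeneracy_in_standard_simplex) auto
  moreover have "sum (simplical_face j x) {..i} = sum x {..i - 1}"
    using assms by (cases i) (auto simp: sum_simplical_face lessThan_Suc_atMost simp del: sum.atMost_Suc)
  ultimately show "singular_face (Suc (Suc r)) j (prism_simplex (Suc r) F i \<sigma>) x =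
         prism_simplex r F (i - 1) (singular_face (Suc r) j \<sigma>) x"
    by (cases "x \<in> standard_simplex (Suc r)")
       (simp_all add: singular_face_def prism_simplex_def degeneracy_simplical_face(1) [OF assms(1)])
qed

text \<open>Vertex \<open>i\<close> occurs twice, so position \<open>j\<close> holds the copy over 1
  of vertex \<open>j - 1\<close>, and that one is omitted. The vertices over 0 all stay, hence the
  same \<open>i\<close>.\<close>

lemma singular_face_prism_simplex_high:
  assumes "Suc i < j" "j \<le> Suc (Suc r)"
  shows "singular_face (Suc (Suc r)) j (prism_simplex (Suc r) F i \<sigma>) =
         prism_simplex r F i (singular_face (Suc r) (j - 1) \<sigma>)"
proof
  fix x
  have "x \<in> standard_simplex (Suc r) \<Longrightarrow> simplical_face j x \<in> standard_simplex (Suc (Suc r))"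
    using assms simplical_face_in_standard_simplex [of "Suc (Suc r)" j x] by simp
  moreover have "x \<in> standard_simplex (Suc r) \<Longrightarrow> degeneracy i x \<in> standard_simplex r"
    using assms by (intro degeneracy_in_standard_simplex) auto
  moreover have "sum (simplical_face j x) {..i} = sum x {..i}"
    using assms by (simp add: sum_simplical_face)
  ultimately show "singular_face (Suc (Suc r)) j (prism_simplex (Suc r) F i \<sigma>) x =
         prism_simplex r F i (singular_face (Suc r) (j - 1) \<sigma>) x"
    by (cases "x \<in> standard_simplex (Suc r)")
       (simp_all add: singular_face_def prism_simplex_def degeneracy_simplical_face(4) [OF assms(1)])
qed

text \<open>Each of these faces omits one of the two copies of vertex \<open>i\<close>. What remains
  is a wall across the prism that depends only on the number of vertices over 0, so consecutive
  prism simplices share it.\<close>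

lemma singular_face_prism_simplex_middle:
  assumes "i \<le> q"
  shows "singular_face (Suc q) i (prism_simplex q F i \<sigma>) =
           (\<lambda>x\<in>standard_simplex q. F (\<sigma> x, 1 - sum x {..<i}))"
    and "singular_face (Suc q) (Suc i) (prism_simplex q F i \<sigma>) =
           (\<lambda>x\<in>standard_simplex q. F (\<sigma> x, 1 - sum x {..<Suc i}))"
  using assms simplical_face_in_standard_simplex [of "Suc q" i]
    simplical_face_in_standard_simplex [of "Suc q" "Suc i"]
  by (auto simp: fun_eq_iff singular_face_def prism_simplex_def degeneracy_simplical_face
      sum_simplical_face lessThan_Suc_atMost simp del: sum.lessThan_Suc)

text \<open>Here \<open>a i j\<close> stands for the value on the \<open>j\<close>-th face of the \<open>i\<close>-th prism simplex over \<open>\<sigma>\<close>,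
  \<open>b i j\<close> for the value on the \<open>i\<close>-th prism simplex over the \<open>j\<close>-th face of \<open>\<sigma>\<close>, and \<open>c i\<close> for the
  value on the inner wall shared by two consecutive prism simplices.\<close>

lemma prism_boundary_sum:
  fixes a b :: "nat \<Rightarrow> nat \<Rightarrow> 'r::comm_ring_1" and c :: "nat \<Rightarrow> 'r"
  assumes low: "\<And>i j. \<lbrakk>j < i; i \<le> Suc r\<rbrakk> \<Longrightarrow> a i j = b (i - 1) j"
    and high: "\<And>i j. \<lbrakk>Suc i < j; j \<le> Suc (Suc r)\<rbrakk> \<Longrightarrow> a i j = b i (j - 1)"
    and middle: "\<And>i. i \<le> Suc r \<Longrightarrow> a i i = c i" "\<And>i. i \<le> Suc r \<Longrightarrow> a i (Suc i) = c (Suc i)"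
  shows "(\<Sum>i\<le>Suc r. \<Sum>j\<le>Suc (Suc r). (-1) ^ (i + j) * a i j) =
         c 0 - c (Suc (Suc r)) - (\<Sum>i\<le>r. \<Sum>j\<le>Suc r. (-1) ^ (i + j) * b i j)"
proof -
  let ?L = "\<lambda>i. \<Sum>j<i. (-1) ^ (i + j) * a i j"
  let ?H = "\<lambda>i. \<Sum>j\<in>{Suc i<..Suc (Suc r)}. (-1) ^ (i + j) * a i j"
  have row: "(\<Sum>j\<le>Suc (Suc r). (-1) ^ (i + j) * a i j) = ?L i + (c i - c (Suc i)) + ?H i"
    if "i \<le> Suc r" for i
  proof -
    have "{..Suc (Suc r)} = ({..<i} \<union> {i, Suc i}) \<union> {Suc i<..Suc (Suc r)}"
      using that by auto
    then have "(\<Sum>j\<le>Suc (Suc r). (-1) ^ (i + j) * a i j)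
        = (\<Sum>j\<in>{..<i} \<union> {i, Suc i}. (-1) ^ (i + j) * a i j) + ?H i"
      by (simp only:) (rule sum.union_disjoint, auto)
    also have "(\<Sum>j\<in>{..<i} \<union> {i, Suc i}. (-1) ^ (i + j) * a i j)
        = ?L i + (\<Sum>j\<in>{i, Suc i}. (-1) ^ (i + j) * a i j)"
      by (rule sum.union_disjoint) auto
    also have "(\<Sum>j\<in>{i, Suc i}. (-1) ^ (i + j) * a i j) = c i - c (Suc i)"
      using that by (simp add: middle flip: mult_2)
    finally show ?thesis .
  qed
  \<comment> \<open>The row \<open>i = 0\<close> is empty; in the others the shift from
    \<open>i\<close> to \<open>i - 1\<close> in \<open>low\<close> flips the sign.\<close>
  have L: "(\<Sum>i\<le>Suc r. ?L i) = - (\<Sum>i\<le>r. \<Sum>j\<le>i. (-1) ^ (i + j) * b i j)"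
  proof -
    have "(\<Sum>i\<le>Suc r. ?L i) = (\<Sum>i\<le>r. ?L (Suc i))"
      by (subst sum.atMost_Suc_shift) simp
    also have "\<dots> = (\<Sum>i\<le>r. - (\<Sum>j\<le>i. (-1) ^ (i + j) * b i j))"
      unfolding lessThan_Suc_atMost sum_negf [symmetric]
      by (intro sum.cong refl) (simp add: low)
    finally show ?thesis by (simp add: sum_negf)
  qed
  \<comment> \<open>Here the shift from \<open>j\<close> to \<open>j - 1\<close> in
    \<open>high\<close> flips the sign, and the row \<open>i = Suc r\<close> is empty.\<close>
  have H: "(\<Sum>i\<le>Suc r. ?H i) = - (\<Sum>i\<le>r. \<Sum>j\<in>{i<..Suc r}. (-1) ^ (i + j) * b i j)"
  proof -
    have "?H i = - (\<Sum>j\<in>{i<..Suc r}. (-1) ^ (i + j) * b i j)" for i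
      unfolding sum_negf [symmetric] atLeastSucAtMost_greaterThanAtMost [symmetric]
        sum.atLeast_Suc_atMost_Suc_shift
      by (rule sum.cong) (simp_all add: high)
    then show ?thesis
      by (simp only: sum.atMost_Suc sum_negf) simp
  qed
  have B: "(\<Sum>j\<le>Suc r. (-1) ^ (i + j) * b i j) =
      (\<Sum>j\<le>i. (-1) ^ (i + j) * b i j) + (\<Sum>j\<in>{i<..Suc r}. (-1) ^ (i + j) * b i j)"
    if "i \<le> r" for i
  proof -
    have "{..Suc r} = {..i} \<union> {i<..Suc r}" using that by auto
    then show ?thesis by (simp only:) (rule sum.union_disjoint, auto)
  qed
  have "(\<Sum>i\<le>Suc r. \<Sum>j\<le>Suc (Suc r). (-1) ^ (i + j) * a i j)
      = (\<Sum>i\<le>Suc r. ?L i) + (\<Sum>i\<le>Suc r. c i - c (Suc i)) + (\<Sum>i\<le>Suc r. ?H i)"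
    unfolding sum.distrib [symmetric] by (rule sum.cong) (simp_all only: row atMost_iff)
  also have "(\<Sum>i\<le>Suc r. c i - c (Suc i)) = c 0 - c (Suc (Suc r))"
    by (rule sum_telescope)
  also have "(\<Sum>i\<le>r. \<Sum>j\<le>Suc r. (-1) ^ (i + j) * b i j) =
      (\<Sum>i\<le>r. \<Sum>j\<le>i. (-1) ^ (i + j) * b i j) + (\<Sum>i\<le>r. \<Sum>j\<in>{i<..Suc r}. (-1) ^ (i + j) * b i j)"
    unfolding sum.distrib [symmetric] by (rule sum.cong) (simp_all only: B atMost_iff)
  ultimately show ?thesis using L H by (simp only:) (simp add: algebra_simps)
qed

text \<open>The prism operator of \<open>F\<close> is a homotopy between the inclusion of
  \<open>V\<close> and a map into \<open>A\<close>. As \<phi> vanishes on \<open>A\<close>, it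
  agrees on simplices of \<open>V\<close> with the coboundary of a cochain \<alpha>, and \<psi> is
  the difference. By \<open>FA\<close> prisms over \<open>A\<close> stay in \<open>A\<close>, so
  \<alpha> is a relative cochain.\<close>

lemma deformable_cocycle:
  fixes \<phi> :: "('a, 'r::comm_ring_1) cochain"
  assumes F: "continuous_map (prod_topology (subtopology X V) unit_interval) X F"
    and F0: "\<And>x. x \<in> topspace X \<inter> V \<Longrightarrow> F (x, 0) = x"
    and F1: "\<And>x. x \<in> topspace X \<inter> V \<Longrightarrow> F (x, 1) \<in> A"
    and FA: "\<And>a t. \<lbrakk>a \<in> topspace X \<inter> A; t \<in> {0..1}\<rbrakk> \<Longrightarrow> F (a, t) \<in> A"
    and AV: "A \<subseteq> V"
    and \<phi>: "\<phi> \<in> relcocycle_set n X A"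
  obtains \<psi> where "\<psi> \<in> relcocycle_set n X A" "\<psi> \<in> relcocycle_set n X V"
    "(\<lambda>\<sigma>. \<phi> \<sigma> - \<psi> \<sigma>) \<in> relcoboundary_set n X A"
proof -
  let ?V = "subtopology X V" and ?A = "subtopology X A"
  have FAc: "continuous_map (prod_topology ?A unit_interval) ?A F"
  proof -
    have "continuous_map (prod_topology ?A unit_interval) X F"
      unfolding prod_topology_subtopology(1)
      by (rule continuous_map_from_subtopology_mono [OF F [unfolded prod_topology_subtopology(1)]])
         (use AV in auto)
    then show ?thesis using FA by (auto simp: continuous_map_in_subtopology)
  qed
  have ext: "\<sigma> \<in> extensional (standard_simplex q)" "\<And>x. x \<in> standard_simplex q \<Longrightarrow> \<sigma> x \<in> topspace X \<inter> V"
    if "singular_simplex q ?V \<sigma>" for q \<sigma>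
    using that by (auto simp: singular_simplex_def continuous_map_def)
  \<comment> \<open>The value of \<phi> on wall \<open>i\<close> of the prism over \<sigma>. Wall
    \<open>Suc n\<close> has height 0 and is \<sigma> itself; wall \<open>0\<close> has height 1 and
    lies in \<open>A\<close>.\<close>
  define c where "c = (\<lambda>\<sigma> i. \<phi> (\<lambda>x\<in>standard_simplex n. F (\<sigma> x, 1 - sum x {..<i})))"
  have cN: "c \<sigma> (Suc n) = \<phi> \<sigma>" if "singular_simplex n ?V \<sigma>" for \<sigma>
  proof -
    have "(\<lambda>x\<in>standard_simplex n. F (\<sigma> x, 1 - sum x {..<Suc n})) = \<sigma>"
    proof
      fix x
      show "(\<lambda>x\<in>standard_simplex n. F (\<sigma> x, 1 - sum x {..<Suc n})) x = \<sigma> x"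
        using ext [OF that] F0
        by (auto simp: lessThan_Suc_atMost standard_simplex_def extensional_def simp del: sum.lessThan_Suc)
    qed
    then show ?thesis by (simp add: c_def)
  qed
  have face0: "singular_simplex n X (\<lambda>x\<in>standard_simplex n. F (\<sigma> x, 1 - sum x {..<0}))"
    if "singular_simplex n ?V \<sigma>" for \<sigma>
  proof -
    \<comment> \<open>Wall \<open>0\<close> inherits its continuity from the prism simplex of which
      it is a face.\<close>
    have "singular_simplex (Suc n) X (prism_simplex n F 0 \<sigma>)"
      using singular_simplex_prism_simplex [OF F that] by simp
    then show ?thesis
      using singular_simplex_singular_face [of "Suc n" X "prism_simplex n F 0 \<sigma>" 0]
      by (simp add: singular_face_prism_simplex_middle(1))
  qed
  have c0: "c \<sigma> 0 = 0" if "singular_simplex n ?V \<sigma>" for \<sigma>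
  proof -
    have "singular_simplex n ?A (\<lambda>x\<in>standard_simplex n. F (\<sigma> x, 1 - sum x {..<0}))"
      using face0 [OF that] ext [OF that] F1 by (auto simp: singular_simplex_subtopology)
    then show ?thesis
      using \<phi> by (auto simp: c_def relcocycle_set_def relcochain_set_def)
  qed
  have prism0: "(\<Sum>j\<le>Suc n. (-1) ^ j * \<phi> (singular_face (Suc n) j (prism_simplex n F i \<sigma>))) = 0"
    if "singular_simplex n ?V \<sigma>" "i \<le> n" for i \<sigma>
    using \<phi> coboundary_simplex [OF singular_simplex_prism_simplex [OF F that], of \<phi>]
    by (simp add: relcocycle_set_def del: sum.atMost_Suc)
  show thesis
  proof (cases n)
    case 0
    \<comment> \<open>Over a point the prism is a path that ends in \<open>A\<close>, and a
      0-cocycle takes the same value at both ends; so \<phi> needs no correction.\<close>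
    have "\<phi> \<sigma> = 0" if \<sigma>: "singular_simplex n ?V \<sigma>" for \<sigma>
      using prism0 [OF \<sigma>, of 0] c0 [OF \<sigma>] cN [OF \<sigma>]
        singular_face_prism_simplex_middle [of 0 n F \<sigma>] by (simp add: 0 c_def)
    with \<phi> have "\<phi> \<in> relcocycle_set n X V"
      by (simp add: relcocycle_set_def relcochain_set_def)
    with \<phi> show thesis
      by (intro that [of \<phi>]) (simp_all add: zero_in_relcoboundary_set)
  next
    case (Suc r)
    \<comment> \<open>The prism operator, with the sign that turns its coboundary into \<phi> on
      \<open>V\<close>. It is extended by 0, since \<open>F\<close> is given only over
      \<open>V\<close>.\<close>
    define \<alpha> where "\<alpha> = (\<lambda>\<tau>. if singular_simplex r ?V \<tau>
        then - (\<Sum>i\<le>r. (-1) ^ i * \<phi> (prism_simplex r F i \<tau>)) else 0)"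
    have \<alpha>: "\<alpha> \<in> relcochain_set r X A"
    proof -
      have "\<alpha> \<tau> = 0" if "singular_simplex r ?A \<tau>" for \<tau>
        using singular_simplex_prism_simplex [OF FAc that] \<phi> Suc
        by (auto simp: \<alpha>_def relcocycle_set_def relcochain_set_def)
      then show ?thesis
        by (auto simp: relcochain_set_def \<alpha>_def singular_simplex_subtopology)
    qed
    define \<psi> where "\<psi> = (\<lambda>\<sigma>. \<phi> \<sigma> - coboundary r X \<alpha> \<sigma>)"
    have cob: "coboundary r X \<alpha> \<in> relcoboundary_set n X A"
      using \<alpha> by (simp add: Suc relcoboundary_set_def)
    have \<psi>A: "\<psi> \<in> relcocycle_set n X A"
      using relcocycle_set_add [OF \<phi> relcocycle_set_minus [OF subsetD [OF relcoboundary_set_subset cob]]]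
      by (simp add: \<psi>_def)
    have "coboundary r X \<alpha> \<sigma> = \<phi> \<sigma>" if \<sigma>: "singular_simplex n ?V \<sigma>" for \<sigma>
    proof -
      let ?b = "\<lambda>i j. \<phi> (prism_simplex r F i (singular_face (Suc r) j \<sigma>))"
      have "(\<Sum>i\<le>Suc r. \<Sum>j\<le>Suc (Suc r).
              (-1) ^ (i + j) * \<phi> (singular_face (Suc (Suc r)) j (prism_simplex (Suc r) F i \<sigma>)))
          = c \<sigma> 0 - c \<sigma> (Suc (Suc r)) - (\<Sum>i\<le>r. \<Sum>j\<le>Suc r. (-1) ^ (i + j) * ?b i j)"
        by (rule prism_boundary_sum)
           (simp_all only: singular_face_prism_simplex_low singular_face_prism_simplex_high
             singular_face_prism_simplex_middle c_def Suc)
      moreover have "(\<Sum>j\<le>Suc (Suc r).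
              (-1) ^ (i + j) * \<phi> (singular_face (Suc (Suc r)) j (prism_simplex (Suc r) F i \<sigma>))) = 0"
        if "i \<le> Suc r" for i
        using prism0 [OF \<sigma>] that unfolding Suc power_add mult.assoc sum_distrib_left [symmetric] by simp
      ultimately have "- \<phi> \<sigma> = (\<Sum>i\<le>r. \<Sum>j\<le>Suc r. (-1) ^ (i + j) * ?b i j)"
        using c0 [OF \<sigma>] cN [OF \<sigma>] by (simp add: Suc del: sum.atMost_Suc)
      from arg_cong [OF this, of uminus] have "\<phi> \<sigma> = - (\<Sum>i\<le>r. \<Sum>j\<le>Suc r. (-1) ^ (i + j) * ?b i j)"
        by (simp only: minus_minus)
      also have "\<dots> = (\<Sum>j\<le>Suc r. (-1) ^ j * - (\<Sum>i\<le>r. (-1) ^ i * ?b i j))"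
        unfolding sum_distrib_left sum_negf [symmetric]
        by (subst sum.swap) (simp add: power_add mult_ac del: sum.atMost_Suc)
      also have "\<dots> = (\<Sum>j\<le>Suc r. (-1) ^ j * \<alpha> (singular_face (Suc r) j \<sigma>))"
        using singular_simplex_singular_face [OF \<sigma>] Suc
        by (intro sum.cong) (simp_all add: \<alpha>_def)
      finally show ?thesis
        using \<sigma> Suc by (simp add: coboundary_simplex singular_simplex_subtopology)
    qed
    then have "\<psi> \<in> relcocycle_set n X V"
      using \<psi>A by (simp add: relcocycle_set_def relcochain_set_def \<psi>_def)
    with \<psi>A show thesis
      by (rule that) (simp add: \<psi>_def cob)
  qed
qed


subsection \<open>Cocycles vanishing on an open cover\<close>

lemma cochain_eval_zero_cochain: "cochain_eval (\<lambda>_. 0) c = 0"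
  by (simp add: cochain_eval_def)

lemma cochain_eval_minus: "cochain_eval \<phi> (- c) = - cochain_eval \<phi> c"
  using cochain_eval_cmul [of \<phi> "-1" c] by simp

lemma cochain_eval_diff: "cochain_eval \<phi> (c - d) = cochain_eval \<phi> c - cochain_eval \<phi> d"
  using cochain_eval_add [of \<phi> c "- d"] by (simp add: cochain_eval_minus)

lemma cochain_eval_eq_0:
  assumes "\<And>\<sigma>. \<sigma> \<in> Poly_Mapping.keys c \<Longrightarrow> \<phi> \<sigma> = 0"
  shows "cochain_eval \<phi> c = 0"
  using assms by (simp add: cochain_eval_def)

lemma cochain_eval_relcochain:
  assumes "\<phi> \<in> relcochain_set n X V" "singular_chain n (subtopology X V) c"
  shows "cochain_eval \<phi> c = 0"
  using assms by (intro cochain_eval_eq_0) (auto simp: relcochain_set_def singular_chain_def)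

lemma cochain_eval_chain_boundary:
  assumes "singular_chain (Suc n) X c"
  shows "cochain_eval \<phi> (chain_boundary (Suc n) c) = cochain_eval (coboundary n X \<phi>) c"
  using assms unfolding singular_chain_def
  by (induction c rule: frag_induction)
     (auto simp: chain_boundary_diff cochain_eval_diff coboundary_def)

lemma cochain_eval_cocycle_chain_boundary:
  assumes "\<phi> \<in> relcocycle_set n X A" "singular_chain (Suc n) X c"
  shows "cochain_eval \<phi> (chain_boundary (Suc n) c) = 0"
  using assms
  by (simp add: cochain_eval_chain_boundary relcocycle_set_def cochain_eval_zero_cochain)

section \<open>Iterated barycentric subdivision\<close>

lemma singular_chain_funpow_subdivision:
  "singular_chain n X c \<Longrightarrow> singular_chain n X ((singular_subdivision n ^^ m) c)"
  by (induction m) (simp_all add: singular_chain_singular_subdivision)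

lemma chain_boundary_funpow_subdivision:
  "singular_chain n X c \<Longrightarrow>
     chain_boundary n ((singular_subdivision n ^^ m) c) =
       (singular_subdivision (n - Suc 0) ^^ m) (chain_boundary n c)"
  by (induction m)
     (simp_all add: chain_boundary_singular_subdivision [OF singular_chain_funpow_subdivision])

text \<open>The number of subdivisions needed depends on the simplex, and a simplex and its faces need not
  agree on it. This is harmless: with \<open>h\<close> the chain homotopy from subdivision to the identity, the
  terms \<open>\<Phi>(h(Sd\<^sup>i \<tau>))\<close> vanish as soon as \<open>Sd\<^sup>i \<tau>\<close> is small, so the sum defining \<open>\<beta> \<tau>\<close> may be
  extended up to any common bound.\<close>

lemma locally_vanishing_cocycle_is_coboundary:
  fixes \<Phi> :: "('a, 'r::comm_ring_1) cochain"
  assumes op: "\<And>V. V \<in> \<V> \<Longrightarrow> openin X V" and cover: "topspace X \<subseteq> \<Union>\<V>"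
    and \<Phi>A: "\<Phi> \<in> relcocycle_set n X A"
    and \<Phi>V: "\<And>V. V \<in> \<V> \<Longrightarrow> \<Phi> \<in> relcocycle_set n X V"
  shows "\<Phi> \<in> relcoboundary_set n X A"
proof -
  define small where "small = (\<lambda>q (c :: 'a chain). Poly_Mapping.keys c \<subseteq> (\<Union>V\<in>\<V>. singular_simplex_set q (subtopology X V)))"
  define Sd where "Sd = (\<lambda>q m. (singular_subdivision q ^^ m) :: 'a chain \<Rightarrow> 'a chain)"
  have Sd_small: "\<exists>m. \<forall>i\<ge>m. small q (Sd q i c)" if c: "singular_chain q X c" for q c
  proof -
    obtain m where m: "\<And>i f. \<lbrakk>m \<le> i; f \<in> Poly_Mapping.keys (Sd q i c)\<rbrakk>
        \<Longrightarrow> \<exists>V\<in>\<V>. f \<in> standard_simplex q \<rightarrow> V"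
      using sufficient_iterated_singular_subdivision_exists [OF op cover c] unfolding Sd_def by metis
    have "f \<in> (\<Union>V\<in>\<V>. singular_simplex_set q (subtopology X V))"
      if "m \<le> i" "f \<in> Poly_Mapping.keys (Sd q i c)" for i f
    proof -
      have "singular_chain q X (Sd q i c)"
        unfolding Sd_def using c by (rule singular_chain_funpow_subdivision)
      then have "singular_simplex q X f" using that(2) by (auto simp: singular_chain_def)
      with m [OF that] show ?thesis
        by (auto simp: singular_simplex_subtopology)
    qed
    then show ?thesis unfolding small_def by blast
  qed
  \<comment> \<open>The homotopy is natural: \<open>hchain\<close> holds for every space, so
    \<open>h\<close> maps chains of a subspace to chains of that subspace. This is used for the
    members of the cover and for \<open>A\<close>.\<close>
  obtain h :: "nat \<Rightarrow> 'a chain \<Rightarrow> 'a chain" where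
        h0: "\<And>p. h p 0 = 0"
    and hdiff: "\<And>p c1 c2. h p (c1-c2) = h p c1 - h p c2"
    and hchain: "\<And>p X c. singular_chain p X c \<Longrightarrow> singular_chain (Suc p) X (h p c)"
    and hbd: "\<And>p X c. singular_chain p X c
                 \<Longrightarrow> chain_boundary (Suc p) (h p c) + h (p - Suc 0) (chain_boundary p c) = singular_subdivision p c - c"
    using chain_homotopic_singular_subdivision by blast
  have \<Phi>small: "cochain_eval \<Phi> c = 0" if "small n c" for c
    using that \<Phi>V by (intro cochain_eval_eq_0) (auto simp: small_def relcocycle_set_def relcochain_set_def)
  \<comment> \<open>The homotopy formula is telescoped along the subdivisions of \<open>c\<close>.
    The term with the boundary of \<open>h\<close> drops out because \<Phi> is a cocycle, the last
    subdivision because it is small.\<close>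
  have split: "cochain_eval \<Phi> c = - (\<Sum>i<m. cochain_eval \<Phi> (h (n - Suc 0) (Sd (n - Suc 0) i (chain_boundary n c))))"
    if c: "singular_chain n X c" and m: "small n (Sd n m c)" for c m
  proof -
    have step: "cochain_eval \<Phi> (Sd n (Suc i) c) - cochain_eval \<Phi> (Sd n i c)
      = cochain_eval \<Phi> (h (n - Suc 0) (Sd (n - Suc 0) i (chain_boundary n c)))" for i
    proof -
      have ci: "singular_chain n X (Sd n i c)"
        unfolding Sd_def using c by (rule singular_chain_funpow_subdivision)
      have "cochain_eval \<Phi> (Sd n (Suc i) c - Sd n i c) =
         cochain_eval \<Phi> (chain_boundary (Suc n) (h n (Sd n i c)))
         + cochain_eval \<Phi> (h (n - Suc 0) (chain_boundary n (Sd n i c)))"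
        using hbd [OF ci] by (simp add: Sd_def flip: cochain_eval_add)
      also have "cochain_eval \<Phi> (chain_boundary (Suc n) (h n (Sd n i c))) = 0"
        using cochain_eval_cocycle_chain_boundary [OF \<Phi>A hchain [OF ci]] .
      finally show ?thesis
        using c by (simp add: cochain_eval_diff Sd_def chain_boundary_funpow_subdivision)
    qed
    have "(\<Sum>i<m. cochain_eval \<Phi> (h (n - Suc 0) (Sd (n - Suc 0) i (chain_boundary n c))))
        = (\<Sum>i<m. cochain_eval \<Phi> (Sd n (Suc i) c) - cochain_eval \<Phi> (Sd n i c))"
      by (simp add: step)
    also have "\<dots> = cochain_eval \<Phi> (Sd n m c) - cochain_eval \<Phi> (Sd n 0 c)"
      by (rule sum_lessThan_telescope)
    finally show ?thesis using \<Phi>small [OF m] by (simp add: Sd_def)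
  qed
  show ?thesis
  proof (cases n)
    case 0
    have "\<Phi> \<sigma> = 0" for \<sigma>
    proof (cases "singular_simplex 0 X \<sigma>")
      case True
      then have c: "singular_chain n X (frag_of \<sigma>)" by (simp add: 0 singular_chain_of)
      then obtain m where "small n (Sd n m (frag_of \<sigma>))" using Sd_small by blast
      \<comment> \<open>The boundary of a 0-chain is 0, so every summand in \<open>split\<close>
        vanishes.\<close>
      from split [OF c this] show ?thesis
        by (simp add: 0 chain_boundary_def Sd_def h0)
    qed (use \<Phi>A 0 in \<open>auto simp: relcocycle_set_def relcochain_set_def\<close>)
    then show ?thesis by (auto simp: 0 relcoboundary_set_def)
  next
    case (Suc r)
    have "\<exists>m. \<forall>\<tau>. singular_simplex r X \<tau> \<longrightarrow> (\<forall>i\<ge>m \<tau>. small r (Sd r i (frag_of \<tau>)))"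
      using Sd_small [of r] by (intro choice) (auto simp: singular_chain_of)
    then obtain m where m: "\<And>\<tau> i. \<lbrakk>singular_simplex r X \<tau>; m \<tau> \<le> i\<rbrakk> \<Longrightarrow> small r (Sd r i (frag_of \<tau>))"
      by blast
    have hsmall: "cochain_eval \<Phi> (h r c) = 0" if "small r c" for c
      using that unfolding small_def
    proof (induction c rule: frag_induction)
      case (one \<tau>)
      then obtain V where V: "V \<in> \<V>" "singular_simplex r (subtopology X V) \<tau>" by blast
      then have "singular_chain n (subtopology X V) (h r (frag_of \<tau>))"
        using hchain [of r "subtopology X V" "frag_of \<tau>"] Suc by (simp add: singular_chain_of)
      then show ?case
        using \<Phi>V [OF V(1)] cochain_eval_relcochain by (auto simp: relcocycle_set_def)
    qed (simp_all add: h0 hdiff cochain_eval_diff)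
    define \<beta> where "\<beta> = (\<lambda>\<tau>. if singular_simplex r X \<tau>
        then - (\<Sum>i<m \<tau>. cochain_eval \<Phi> (h r (Sd r i (frag_of \<tau>)))) else 0)"
    have \<beta>: "\<beta> \<tau> = - (\<Sum>i<N. cochain_eval \<Phi> (h r (Sd r i (frag_of \<tau>))))"
      if \<tau>: "singular_simplex r X \<tau>" and N: "m \<tau> \<le> N" for \<tau> N
    proof -
      have "(\<Sum>i<m \<tau>. cochain_eval \<Phi> (h r (Sd r i (frag_of \<tau>)))) = (\<Sum>i<N. cochain_eval \<Phi> (h r (Sd r i (frag_of \<tau>))))"
        by (rule sum.mono_neutral_left) (use N hsmall m [OF \<tau>] in \<open>auto simp: not_less\<close>)
      then show ?thesis using \<tau> by (simp add: \<beta>_def)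
    qed
    have Sddiff: "Sd r i (a - b) = Sd r i a - Sd r i b" for i a b
      unfolding Sd_def by (rule singular_subdivision_power_diff)
    \<comment> \<open>A chain has finitely many simplices, so a common bound exists; validity for
      all larger \<open>N\<close> allows two bounds to be merged in the induction.\<close>
    have \<beta>chain: "\<exists>M. \<forall>N\<ge>M. cochain_eval \<beta> c = - (\<Sum>i<N. cochain_eval \<Phi> (h r (Sd r i c)))"
      if "singular_chain r X c" for c
      using that unfolding singular_chain_def
    proof (induction c rule: frag_induction)
      case zero
      then show ?case by (simp add: Sd_def h0)
    next
      case (one \<tau>)
      then show ?case using \<beta> by auto
    next
      case (diff a b)
      then obtain M M' where ab:
        "\<And>N. N \<ge> M \<Longrightarrow> cochain_eval \<beta> a = - (\<Sum>i<N. cochain_eval \<Phi> (h r (Sd r i a)))"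
        "\<And>N. N \<ge> M' \<Longrightarrow> cochain_eval \<beta> b = - (\<Sum>i<N. cochain_eval \<Phi> (h r (Sd r i b)))" by blast
      have "cochain_eval \<beta> (a - b) = - (\<Sum>i<N. cochain_eval \<Phi> (h r (Sd r i (a - b))))"
        if "N \<ge> max M M'" for N
      proof -
        have "cochain_eval \<beta> a = - (\<Sum>i<N. cochain_eval \<Phi> (h r (Sd r i a)))"
          "cochain_eval \<beta> b = - (\<Sum>i<N. cochain_eval \<Phi> (h r (Sd r i b)))"
          using that by (auto intro: ab)
        then show ?thesis
          by (simp only: cochain_eval_diff Sddiff hdiff sum_subtractf) simp
      qed
      then show ?case by blast
    qed
    have "coboundary r X \<beta> = \<Phi>"
    proof
      fix \<sigma>
      show "coboundary r X \<beta> \<sigma> = \<Phi> \<sigma>"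
      proof (cases "singular_simplex (Suc r) X \<sigma>")
        case True
        then have c: "singular_chain n X (frag_of \<sigma>)" by (simp add: Suc singular_chain_of)
        then have "singular_chain r X (chain_boundary (Suc r) (frag_of \<sigma>))"
          using singular_chain_boundary_alt Suc by blast
        from \<beta>chain [OF this] obtain M where M: "\<And>N. N \<ge> M \<Longrightarrow>
            cochain_eval \<beta> (chain_boundary (Suc r) (frag_of \<sigma>)) =
            - (\<Sum>i<N. cochain_eval \<Phi> (h r (Sd r i (chain_boundary (Suc r) (frag_of \<sigma>)))))" by blast
        obtain M' where M': "\<And>i. i \<ge> M' \<Longrightarrow> small n (Sd n i (frag_of \<sigma>))"
          using Sd_small [OF c] by blast
        \<comment> \<open>At \<open>max M M'\<close> the formulas for \<beta> on the boundary of
          \<sigma> and for \<Phi> on \<sigma> use the same number of subdivisions, and their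
          right-hand sides coincide.\<close>
        show ?thesis
          using split [OF c M', of "max M M'"] M [of "max M M'"] True
          by (simp add: Suc coboundary_def)
      next
        case False
        then show ?thesis
          using \<Phi>A Suc by (auto simp: coboundary_def relcocycle_set_def relcochain_set_def)
      qed
    qed
    moreover have "\<beta> \<in> relcochain_set r X A"
    proof -
      have "\<beta> \<tau> = 0" if \<tau>: "singular_simplex r (subtopology X A) \<tau>" for \<tau>
      proof -
        have "singular_chain n (subtopology X A) (h r (Sd r i (frag_of \<tau>)))" for i
          using \<tau> hchain [of r "subtopology X A"]
          by (simp add: Suc Sd_def singular_chain_of singular_chain_funpow_subdivision)
        then have "cochain_eval \<Phi> (h r (Sd r i (frag_of \<tau>))) = 0" for i
          using cochain_eval_relcochain [OF relcocycle_setD [OF \<Phi>A]] by blast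
        then show ?thesis by (simp add: \<beta>_def)
      qed
      then show ?thesis by (simp add: relcochain_set_def \<beta>_def)
    qed
    ultimately show ?thesis by (auto simp: Suc relcoboundary_set_def)
  qed
qed


subsection \<open>Cup products of classes represented by vanishing cocycles\<close>

lemma cup_cochain_in_relcochain_set_right:
  assumes "\<psi> \<in> relcochain_set q X A"
  shows "cup_cochain p q X \<phi> \<psi> \<in> relcochain_set (p + q) X A"
  using assms singular_simplex_back_face [of p q "subtopology X A"]
  by (auto simp: relcochain_set_def cup_cochain_def)

text \<open>The coboundary condition does not mention the subspace.\<close>

lemma relcocycle_set_if_relcochain:
  "\<lbrakk>\<phi> \<in> relcocycle_set n X A; \<phi> \<in> relcochain_set n X V\<rbrakk> \<Longrightarrow> \<phi> \<in> relcocycle_set n X V"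
  by (simp add: relcocycle_set_def)

text \<open>The classes relative to \<open>A\<close> with one representative that vanishes on each
  member of the family. A family is kept instead of its union because nothing is asked of simplices
  that lie in the union but in no single member.\<close>

definition vanishing_classes ::
    "nat \<Rightarrow> 'a topology \<Rightarrow> 'a set \<Rightarrow> 'a set set \<Rightarrow> ('a, 'r::comm_ring_1) cochain set set" where
  "vanishing_classes n X A \<V> =
     cohomology_class n X A ` {\<phi>. \<forall>V\<in>insert A \<V>. \<phi> \<in> relcocycle_set n X V}"

lemma vanishing_classes_subset_carrier:
  "vanishing_classes n X A \<V> \<subseteq> carrier (relative_cohomology_group n X A)"
  by (auto simp: vanishing_classes_def carrier_relative_cohomology_group)

lemma mult_cohomology_class:
  assumes "\<phi> \<in> relcocycle_set n X A" "\<psi> \<in> relcocycle_set n X A"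
  shows "cohomology_class n X A \<phi> \<otimes>\<^bsub>relative_cohomology_group n X A\<^esub> cohomology_class n X A \<psi>
         = cohomology_class n X A (\<lambda>\<sigma>. \<phi> \<sigma> + \<psi> \<sigma>)"
proof -
  interpret comm_group "relcocycle_group n X A" by (rule comm_group_relcocycle_group)
  interpret normal "relcoboundary_set n X A" "relcocycle_group n X A"
    by (rule subgroup_imp_normal) (rule subgroup_relcoboundary_set)
  show ?thesis
    using rcos_sum [of \<phi> \<psi>] assms
    by (simp add: relative_cohomology_group_def cohomology_class_def relcocycle_group_def)
qed

lemma cohomology_class_zero: "cohomology_class n X A (\<lambda>_. 0) = relcoboundary_set n X A"
  by (auto simp: cohomology_class_iff)

text \<open>Representatives can be added. This is needed because a cup product in a fixed degree is
  a sum over bidegrees.\<close>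

lemma finprod_vanishing_classes:
  assumes "finite I" "\<And>i. i \<in> I \<Longrightarrow> f i \<in> vanishing_classes n X A \<V>"
  shows "finprod (relative_cohomology_group n X A) f I \<in> vanishing_classes n X A \<V>"
proof -
  interpret comm_group "relative_cohomology_group n X A"
    by (rule comm_group_relative_cohomology_group)
  show ?thesis
    using assms
  proof (induction I rule: finite_induct)
    case empty
    have "(\<lambda>_. 0) \<in> relcocycle_set n X V" for V
      using zero_in_relcoboundary_set relcoboundary_set_subset by blast
    then show ?case
      by (auto simp: vanishing_classes_def one_relative_cohomology_group
          simp flip: cohomology_class_zero)
  next
    case (insert i I)
    have f: "f j \<in> carrier (relative_cohomology_group n X A)" if "j \<in> insert i I" for j
      using insert.prems [OF that] vanishing_classes_subset_carrier by blast
    have "f i \<otimes>\<^bsub>relative_cohomology_group n X A\<^esub> finprod (relative_cohomology_group n X A) f I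
        \<in> vanishing_classes n X A \<V>"
    proof -
      obtain \<phi> \<psi> where "f i = cohomology_class n X A \<phi>" "\<forall>V\<in>insert A \<V>. \<phi> \<in> relcocycle_set n X V"
        "finprod (relative_cohomology_group n X A) f I = cohomology_class n X A \<psi>"
        "\<forall>V\<in>insert A \<V>. \<psi> \<in> relcocycle_set n X V"
        using insert.IH insert.prems unfolding vanishing_classes_def by blast
      then show ?thesis
        by (auto simp: vanishing_classes_def mult_cohomology_class relcocycle_set_add
            intro!: image_eqI [of _ _ "\<lambda>\<sigma>. \<phi> \<sigma> + \<psi> \<sigma>"])
    qed
    then show ?case
      using insert.hyps f by (simp add: finprod_insert Pi_iff)
  qed
qed

text \<open>Front and back faces of a simplex of \<open>V\<close> lie in \<open>V\<close>, so a
  product of cocycles vanishes on \<open>V\<close> as soon as one factor does. Hence the two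
  families are united.\<close>

lemma cup_class_vanishing_classes:
  assumes "a \<in> vanishing_classes m X A \<V>" "b \<in> vanishing_classes n X A \<W>"
  shows "cup_class m n X A a b \<in> vanishing_classes (m + n) X A (\<V> \<union> \<W>)"
proof -
  obtain \<phi> \<psi> where \<phi>: "a = cohomology_class m X A \<phi>" "\<And>V. V \<in> insert A \<V> \<Longrightarrow> \<phi> \<in> relcocycle_set m X V"
    and \<psi>: "b = cohomology_class n X A \<psi>" "\<And>V. V \<in> insert A \<W> \<Longrightarrow> \<psi> \<in> relcocycle_set n X V"
    using assms unfolding vanishing_classes_def by blast
  have cup: "cup_cochain m n X \<phi> \<psi> \<in> relcocycle_set (m + n) X A"
    by (simp add: cup_cochain_in_relcocycle_set \<phi>(2) \<psi>(2))
  have "cup_cochain m n X \<phi> \<psi> \<in> relcochain_set (m + n) X V" if "V \<in> \<V> \<union> \<W>" for V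
    using that \<phi>(2) [of V] \<psi>(2) [of V]
    by (auto intro: cup_cochain_in_relcochain_set cup_cochain_in_relcochain_set_right relcocycle_setD)
  with cup have "\<forall>V\<in>insert A (\<V> \<union> \<W>). cup_cochain m n X \<phi> \<psi> \<in> relcocycle_set (m + n) X V"
    using relcocycle_set_if_relcochain by blast
  moreover have "cup_class m n X A a b = cohomology_class (m + n) X A (cup_cochain m n X \<phi> \<psi>)"
    using \<phi> \<psi> by (simp add: cup_class_cohomology_class)
  ultimately show ?thesis unfolding vanishing_classes_def by blast
qed

lemma cup_vanishing_classes:
  assumes "\<And>n. v n \<in> vanishing_classes n X A \<V>" "\<And>n. w n \<in> vanishing_classes n X A \<W>"
  shows "cup X A v w n \<in> vanishing_classes n X A (\<V> \<union> \<W>)"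
  unfolding cup_def
proof (rule finprod_vanishing_classes)
  fix i assume "i \<in> {..n}"
  then show "cup_class i (n - i) X A (v i) (w (n - i)) \<in> vanishing_classes n X A (\<V> \<union> \<W>)"
    using cup_class_vanishing_classes [OF assms, of i "n - i"] by simp
qed simp

text \<open>Each factor contributes its own set. The product starts with \<open>v 1\<close> instead
  of a unit, so the induction starts at \<open>k = 1\<close> with an empty list.\<close>

lemma foldl_cup_vanishing_classes:
  assumes "1 \<le> k" "\<And>i n. i \<in> {1..k} \<Longrightarrow> v i n \<in> vanishing_classes n X A {V i}"
  shows "foldl (cup X A) (v 1) (map v [2..<Suc k]) n \<in> vanishing_classes n X A (V ` {1..k})"
  using assms
proof (induction k arbitrary: n rule: dec_induct)
  case base
  then show ?case by simp
next
  case (step k)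
  have "cup X A (foldl (cup X A) (v 1) (map v [2..<Suc k])) (v (Suc k)) n
      \<in> vanishing_classes n X A (V ` {1..k} \<union> {V (Suc k)})"
    by (rule cup_vanishing_classes) (use step in auto)
  moreover have "V ` {1..k} \<union> {V (Suc k)} = V ` {1..Suc k}"
    by (simp add: atLeastAtMostSuc_conv)
  ultimately show ?case
    using step.hyps by (simp add: numeral_2_eq_2)
qed

text \<open>By \<open>deformable_cocycle\<close> every class has a representative that also vanishes
  on \<open>V\<close>.\<close>

lemma vanishing_classes_deformable:
  assumes F: "continuous_map (prod_topology (subtopology X V) unit_interval) X F"
    and F0: "\<And>x. x \<in> topspace X \<inter> V \<Longrightarrow> F (x, 0) = x"
    and F1: "\<And>x. x \<in> topspace X \<inter> V \<Longrightarrow> F (x, 1) \<in> A"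
    and FA: "\<And>a t. \<lbrakk>a \<in> topspace X \<inter> A; t \<in> {0..1}\<rbrakk> \<Longrightarrow> F (a, t) \<in> A"
    and AV: "A \<subseteq> V"
  shows "vanishing_classes n X A {V} = carrier (relative_cohomology_group n X A)"
proof
  show "carrier (relative_cohomology_group n X A) \<subseteq> vanishing_classes n X A {V}"
  proof
    fix a assume "a \<in> carrier (relative_cohomology_group n X A)"
    then obtain \<phi> where \<phi>: "\<phi> \<in> relcocycle_set n X A" "a = cohomology_class n X A \<phi>"
      by (auto simp: carrier_relative_cohomology_group)
    obtain \<psi> where "\<psi> \<in> relcocycle_set n X A" "\<psi> \<in> relcocycle_set n X V"
      "(\<lambda>\<sigma>. \<phi> \<sigma> - \<psi> \<sigma>) \<in> relcoboundary_set n X A"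
      using deformable_cocycle [OF F F0 F1 FA AV \<phi>(1)] by blast
    moreover from this(3) have "a = cohomology_class n X A \<psi>"
      using \<phi>(2) cohomology_class_eqI by blast
    ultimately show "a \<in> vanishing_classes n X A {V}"
      by (auto simp: vanishing_classes_def)
  qed
qed (rule vanishing_classes_subset_carrier)

lemma vanishing_classes_cover:
  assumes "\<And>V. V \<in> \<V> \<Longrightarrow> openin X V" "topspace X \<subseteq> \<Union>\<V>"
  shows "vanishing_classes n X A \<V> \<subseteq> {\<one>\<^bsub>relative_cohomology_group n X A\<^esub>}"
proof
  fix a assume "a \<in> vanishing_classes n X A \<V>"
  then obtain \<Phi> where a: "a = cohomology_class n X A \<Phi>"
    and \<Phi>: "\<And>V. V \<in> insert A \<V> \<Longrightarrow> \<Phi> \<in> relcocycle_set n X V"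
    unfolding vanishing_classes_def by blast
  have "\<Phi> \<in> relcoboundary_set n X A"
    by (rule locally_vanishing_cocycle_is_coboundary [OF assms]) (auto intro: \<Phi>)
  then have "cohomology_class n X A \<Phi> = cohomology_class n X A (\<lambda>_. 0)"
    by (intro cohomology_class_eqI) simp
  then show "a \<in> {\<one>\<^bsub>relative_cohomology_group n X A\<^esub>}"
    by (simp add: a one_relative_cohomology_group cohomology_class_zero)
qed


subsection \<open>The fibrewise symmetric square\<close>

lemma swap_orbit_eq_iff: "swap_orbit z = swap_orbit w \<longleftrightarrow> z = w \<or> z = prod.swap w"
  by (cases z; cases w) (auto simp: swap_orbit_def doubleton_eq_iff)

text \<open>Invariance is saturation for the orbit map. It makes images of invariant open sets open
  and lets the orbit map restrict to a quotient map.\<close>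

lemma swap_orbit_vimage:
  assumes "U \<subseteq> topspace (fibre_square E p)" "prod.swap ` U = U"
  shows "{z \<in> topspace (fibre_square E p). swap_orbit z \<in> swap_orbit ` U} = U"
  using assms by (auto simp: swap_orbit_eq_iff)

lemma openin_swap_orbit_image:
  assumes "openin (fibre_square E p) U" "prod.swap ` U = U"
  shows "openin (fibre_sym_square E p) (swap_orbit ` U)"
  using assms swap_orbit_vimage [OF openin_subset [OF assms(1)] assms(2)] openin_subset [OF assms(1)]
  by (auto simp: fibre_sym_square_def openin_quotient_topology)

text \<open>The two endpoints run along the path towards its midpoint and meet there at time 1. The
  pair stays in the fibre square because each path lies in one fibre; continuity comes from joint
  continuity of evaluation.\<close>

lemma fibre_path_homotopy:
  assumes s: "continuous_map Z (fibre_path_space E p) s"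
  shows "continuous_map (prod_topology Z unit_interval) (fibre_square E p)
           (\<lambda>(z, t). (s z (t / 2), s z (1 - t / 2)))"
proof -
  let ?C = "compact_open_topology unit_interval E"
  have s': "continuous_map Z ?C s"
    using s by (simp add: fibre_path_space_def continuous_map_in_subtopology)
  have half: "continuous_map (prod_topology Z unit_interval) E (\<lambda>w. s (fst w) (g (snd w)))"
    if g: "continuous_on {0..1} g" "g \<in> {0..1} \<rightarrow> {0..1}" for g :: "real \<Rightarrow> real"
  proof -
    have "continuous_map unit_interval unit_interval g"
      using g by (simp add: continuous_map_in_subtopology Pi_iff image_subset_iff)
    then have "continuous_map (prod_topology Z unit_interval) (prod_topology ?C unit_interval)
        (\<lambda>w. (s (fst w), g (snd w)))"
      using continuous_map_compose [OF continuous_map_fst s']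
        continuous_map_compose [OF continuous_map_snd, of unit_interval unit_interval g Z]
      by (simp add: continuous_map_pairwise o_def)
    from continuous_map_compose [OF this continuous_map_path_eval]
    show ?thesis by (simp add: o_def)
  qed
  have p: "p (s z t) = p (s z u)" if "z \<in> topspace Z" "t \<in> {0..1}" "u \<in> {0..1}" for z t u
    using continuous_map_image_subset_topspace [OF s] that
    by (force simp: fibre_path_space_def)
  have "continuous_map (prod_topology Z unit_interval) (fibre_square E p)
          (\<lambda>w. (s (fst w) (snd w / 2), s (fst w) (1 - snd w / 2)))"
    unfolding fibre_square_def continuous_map_in_subtopology continuous_map_pairwise o_def fst_conv snd_conv
  proof (intro conjI)
    show "continuous_map (prod_topology Z unit_interval) E (\<lambda>w. s (fst w) (snd w / 2))"
      by (rule half) (auto intro!: continuous_intros)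
    show "continuous_map (prod_topology Z unit_interval) E (\<lambda>w. s (fst w) (1 - snd w / 2))"
      by (rule half) (auto intro!: continuous_intros)
    show "(\<lambda>w. (s (fst w) (snd w / 2), s (fst w) (1 - snd w / 2)))
            \<in> topspace (prod_topology Z unit_interval) \<rightarrow> {(e1, e2). p e1 = p e2}"
      by (auto intro: p)
  qed
  then show ?thesis by (simp add: case_prod_unfold)
qed

lemma monoidal_symmetrized_domain_deformation:
  assumes "monoidal_symmetrized_domain E p U"
  obtains F where
    "continuous_map (prod_topology (subtopology (fibre_sym_square E p) (swap_orbit ` U)) unit_interval)
       (fibre_sym_square E p) F"
    "\<And>x. x \<in> swap_orbit ` U \<Longrightarrow> F (x, 0) = x"
    "\<And>x. x \<in> swap_orbit ` U \<Longrightarrow> F (x, 1) \<in> fibre_sym_diagonal E"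
    "\<And>a t. \<lbrakk>a \<in> fibre_sym_diagonal E; t \<in> {0..1}\<rbrakk> \<Longrightarrow> F (a, t) \<in> fibre_sym_diagonal E"
proof -
  let ?Q = "fibre_square E p" and ?SP = "fibre_sym_square E p"
  from assms obtain s where U: "openin ?Q U" "prod.swap ` U = U" "fibre_diagonal E \<subseteq> U"
    and s: "continuous_map (subtopology ?Q U) (fibre_path_space E p) s"
    and ends: "\<And>z. z \<in> U \<Longrightarrow> path_endpoints (s z) = z"
    and equi: "\<And>z. z \<in> U \<Longrightarrow> s (prod.swap z) = reverse_path (s z)"
    and const: "\<And>e. e \<in> topspace E \<Longrightarrow> s (e, e) = const_path e"
    unfolding monoidal_symmetrized_domain_def by blast
  have UQ: "U \<subseteq> topspace ?Q" using U(1) by (rule openin_subset)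
  have tU: "topspace (subtopology ?Q U) = U" using UQ by auto
  define H where "H = (\<lambda>(z, t). (s z (t / 2), s z (1 - t / 2)))"
  have q: "quotient_map ?Q ?SP swap_orbit"
    by (simp add: fibre_sym_square_def quotient_map_quotient_topology)
  have qU: "quotient_map (subtopology ?Q U) (subtopology ?SP (swap_orbit ` U)) swap_orbit"
    using quotient_map_restriction [OF q swap_orbit_vimage [OF UQ U(2)]]
      openin_swap_orbit_image [OF U(1,2)] by blast
  \<comment> \<open>The product of a quotient map with the identity of the interval is again a
    quotient map, since the interval is locally compact and Hausdorff. So a homotopy constant on
    orbits descends continuously.\<close>
  have qUI: "quotient_map (prod_topology (subtopology ?Q U) unit_interval)
      (prod_topology (subtopology ?SP (swap_orbit ` U)) unit_interval) (\<lambda>(z, t). (swap_orbit z, t))"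
    by (rule quotient_map_prod_left [OF _ _ qU])
       (simp_all add: Hausdorff_space_subtopology compact_imp_locally_compact_space
          compact_space_subtopology compactin_euclidean_iff)
  have H: "continuous_map (prod_topology (subtopology ?Q U) unit_interval) ?SP (swap_orbit \<circ> H)"
    unfolding H_def
    using fibre_path_homotopy [OF s] quotient_imp_continuous_map [OF q] continuous_map_compose by blast
  \<comment> \<open>Reversing a path exchanges the parameters \<open>t / 2\<close> and
    \<open>1 - t / 2\<close>, that is, the two components of \<open>H\<close>.\<close>
  have swap: "H (prod.swap z, t) = prod.swap (H (z, t))" if "z \<in> U" "t \<in> {0..1}" for z t
    using that by (simp add: H_def equi reverse_path_def)
  have "(swap_orbit \<circ> H) w = (swap_orbit \<circ> H) w'"
    if "w \<in> topspace (prod_topology (subtopology ?Q U) unit_interval)"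
       "w' \<in> topspace (prod_topology (subtopology ?Q U) unit_interval)"
       "(\<lambda>(z, t). (swap_orbit z, t)) w = (\<lambda>(z, t). (swap_orbit z, t)) w'" for w w'
    using that swap by (cases w; cases w') (auto simp: swap_orbit_eq_iff tU simp del: swap_simp)
  with quotient_map_lift_exists [OF qUI H] obtain F
    where F: "continuous_map (prod_topology (subtopology ?SP (swap_orbit ` U)) unit_interval) ?SP F"
      and FH: "\<And>w. w \<in> topspace (prod_topology (subtopology ?Q U) unit_interval)
        \<Longrightarrow> F ((\<lambda>(z, t). (swap_orbit z, t)) w) = (swap_orbit \<circ> H) w"
    by metis
  have FH': "F (swap_orbit z, t) = swap_orbit (H (z, t))" if "z \<in> U" "t \<in> {0..1}" for z t
    using FH [of "(z, t)"] that UQ by auto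
  show ?thesis
  proof
    show "F (x, 0) = x" if x: "x \<in> swap_orbit ` U" for x
    proof -
      obtain z where z: "z \<in> U" "x = swap_orbit z" using x by blast
      then show ?thesis
        using FH' [OF z(1), of 0] ends [OF z(1)] by (simp add: H_def path_endpoints_def)
    qed
    show "F (x, 1) \<in> fibre_sym_diagonal E" if x: "x \<in> swap_orbit ` U" for x
    proof -
      obtain z where z: "z \<in> U" "x = swap_orbit z" using x by blast
      have "continuous_map unit_interval E (s z)"
        using continuous_map_image_subset_topspace [OF s] z(1) tU
        by (auto simp: fibre_path_space_def topspace_compact_open_topology)
      \<comment> \<open>At time 1 both components of \<open>H\<close> are this midpoint, so the
        orbit is diagonal.\<close>
      then have "s z (1 / 2) \<in> topspace E"
        using continuous_map_image_subset_topspace by fastforce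
      then show ?thesis
        using FH' [OF z(1), of 1] z(2)
        by (auto simp: H_def fibre_sym_diagonal_def fibre_diagonal_def)
    qed
    show "F (a, t) \<in> fibre_sym_diagonal E"
      if a: "a \<in> fibre_sym_diagonal E" and t: "t \<in> {0..1}" for a t
    proof -
      obtain e where e: "e \<in> topspace E" "a = swap_orbit (e, e)"
        using a by (auto simp: fibre_sym_diagonal_def fibre_diagonal_def)
      then have eU: "(e, e) \<in> U" using U(3) by (auto simp: fibre_diagonal_def)
      have "H ((e, e), t) = (e, e)"
        using const [OF e(1)] t by (simp add: H_def const_path_def)
      then show ?thesis
        using FH' [OF eU t] e a by simp
    qed
  qed (rule F)
qed


section \<open>The lower bound from a nonzero cup product\<close>

theorem theorem5p8:
  fixes E :: "'e topology" and B :: "'b topology" and p :: "'e \<Rightarrow> 'b"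
    and v :: "nat \<Rightarrow> nat \<Rightarrow> (('e \<times> 'e) set, 'r::comm_ring_1) cochain set" and k :: nat
  assumes "hurewicz_fibration E B p"
    and "1 \<le> k"
    and "\<And>i. i \<in> {1..k} \<Longrightarrow>
           v i \<in> carrier (relative_cohomology (fibre_sym_square E p) (fibre_sym_diagonal E))"
    and "foldl (cup (fibre_sym_square E p) (fibre_sym_diagonal E)) (v 1) (map v [2..<Suc k])
           \<noteq> \<one>\<^bsub>relative_cohomology (fibre_sym_square E p) (fibre_sym_diagonal E)\<^esub>"
  shows "TC_monoidal_symmetrized E p \<ge> enat k"
  unfolding TC_monoidal_symmetrized_def
\<comment> \<open>Bounding every admissible value also settles the case without any, where the
  infimum is \<infinity>.\<close>
proof (rule Inf_greatest)
  let ?X = "fibre_sym_square E p" and ?A = "fibre_sym_diagonal E"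
  fix m
  assume "m \<in> {enat n |n. \<exists>U :: nat \<Rightarrow> ('e \<times> 'e) set.
            (\<forall>i\<le>n. monoidal_symmetrized_domain E p (U i)) \<and>
            topspace (fibre_square E p) = (\<Union>i\<le>n. U i)}"
  then obtain n U where m: "m = enat n"
    and U: "\<And>i. i \<le> n \<Longrightarrow> monoidal_symmetrized_domain E p (U i)"
    and cover: "topspace (fibre_square E p) = (\<Union>i\<le>n. U i)" by blast
  have "k \<le> n"
  proof (rule ccontr)
    assume "\<not> k \<le> n"
    then have nk: "n < k" by simp
    \<comment> \<open>Classes are numbered from 1 and domains from 0, hence \<open>i - 1\<close>.
      With \<open>n < k\<close> there are at most \<open>k\<close> domains; \<open>min\<close>
      repeats the last one, so that each class gets a domain and all domains occur.\<close>
    define V where "V = (\<lambda>i. swap_orbit ` U (min (i - 1) n))"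
    have dom: "monoidal_symmetrized_domain E p (U (min (i - 1) n))" for i
      by (rule U) simp
    have V_open: "openin ?X (V i)" for i
      using dom [of i] openin_swap_orbit_image by (auto simp: V_def monoidal_symmetrized_domain_def)
    have "topspace ?X = (\<Union>i\<le>n. swap_orbit ` U i)"
      by (simp add: fibre_sym_square_def topspace_quotient_topology cover image_UN)
    also have "\<dots> \<subseteq> (\<Union>i\<in>{1..k}. V i)"
    proof (rule UN_least)
      fix i assume "i \<in> {..n}"
      then have "swap_orbit ` U i = V (Suc i)" "Suc i \<in> {1..k}"
        using nk by (simp_all add: V_def)
      then show "swap_orbit ` U i \<subseteq> (\<Union>i\<in>{1..k}. V i)" by blast
    qed
    finally have V_cover: "topspace ?X \<subseteq> \<Union>(V ` {1..k})" .
    have v: "v i q \<in> vanishing_classes q ?X ?A {V i}" if i: "i \<in> {1..k}" for i q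
    proof -
      have AV: "?A \<subseteq> V i"
        using dom [of i]
        unfolding V_def fibre_sym_diagonal_def monoidal_symmetrized_domain_def by blast
      obtain F where F: "continuous_map (prod_topology (subtopology ?X (V i)) unit_interval) ?X F"
        "\<And>x. x \<in> V i \<Longrightarrow> F (x, 0) = x" "\<And>x. x \<in> V i \<Longrightarrow> F (x, 1) \<in> ?A"
        "\<And>a t. \<lbrakk>a \<in> ?A; t \<in> {0..1}\<rbrakk> \<Longrightarrow> F (a, t) \<in> ?A"
        using monoidal_symmetrized_domain_deformation [OF dom [of i]] unfolding V_def by blast
      have "vanishing_classes q ?X ?A {V i} =
          (carrier (relative_cohomology_group q ?X ?A) :: (('e \<times> 'e) set, 'r) cochain set set)"
        by (rule vanishing_classes_deformable [OF F(1) _ _ _ AV]) (use F(2-4) in auto)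
      then show ?thesis
        using assms(3) [OF i] by (simp add: carrier_relative_cohomology)
    qed
    have "foldl (cup ?X ?A) (v 1) (map v [2..<Suc k]) q = \<one>\<^bsub>relative_cohomology_group q ?X ?A\<^esub>" for q
    proof -
      have "foldl (cup ?X ?A) (v 1) (map v [2..<Suc k]) q \<in> vanishing_classes q ?X ?A (V ` {1..k})"
        using assms(2) v by (rule foldl_cup_vanishing_classes)
      also have "\<dots> \<subseteq> {\<one>\<^bsub>relative_cohomology_group q ?X ?A\<^esub>}"
        by (rule vanishing_classes_cover) (use V_open V_cover in auto)
      finally show ?thesis by simp
    qed
    then have "foldl (cup ?X ?A) (v 1) (map v [2..<Suc k]) = \<one>\<^bsub>relative_cohomology ?X ?A\<^esub>"
      by (simp add: relative_cohomology_def fun_eq_iff)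
    with assms(4) show False by contradiction
  qed
  then show "enat k \<le> m" by (simp add: m)
qed

end
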